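(* Let $\hat m$ be a model size satisfying the stopping rule. Conditionally on the event that the null hypothesis $X\beta^0\in H_{\hat m}$ holds and that $(\hat\imath_1,\ldots,\hat\imath_K)$ satisfies the Irrepresentable Check (assumed of positive probability), $$\hat\alpha_{\hat m(\hat m+1)(K+1)}:=1-\frac{\mathbb F_{\hat m(\hat m+1)(K+1)}(\lambda_{\hat m+1})}{\mathbb F_{\hat m(\hat m+1)(K+1)}(\lambda_{\hat m})}$$ is uniformly distributed on $(0,1)$.
   Context: Notation: $[m]=\{1,\ldots,m\}$. Let $X\in\mathbb R^{n\times p}$ be a fixed matrix of rank $r>0$ with columns $X_1,\ldots,X_p$, and $Y=X\beta^0+\eta$ with $\beta^0\in\mathbb R^p$, $\eta\sim\mathcal N_n(0,\sigma^2\mathrm{Id}_n)$, $\sigma>0$ known. $K$ is a fixed integer with $1\le K<\min(n,r)$. Signed indices: $i\in[2p]$ encodes a variable $j\in[p]$ and a sign $s\in\{\pm1\}$ via $i=j+p\frac{1-s}{2}$. Put $\bar Z=X^\top Y$, $Z=(\bar Z,-\bar Z)\in\mathbb R^{2p}$, with covariance $\sigma^2R$, $R=\begin{pmatrix}X^\top X&-X^\top X\\-X^\top X&X^\top X\end{pmatrix}$. For $i_1,\ldots,i_k\in[2p]$ let $M_{i_1,\ldots,i_k}$ be the submatrix of $R$ with rows and columns indexed by $i_1,\ldots,i_k$, and for $j\in[2p]$ let $\theta_j(i_1,\ldots,i_k)=(R_{j,i_1}\cdots R_{j,i_k})M_{i_1,\ldots,i_k}^{-1}(1,\ldots,1)^\top$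 and $\Pi_{i_1,\ldots,i_k}(Z_j)=(R_{j,i_1}\cdots R_{j,i_k})M_{i_1,\ldots,i_k}^{-1}(Z_{i_1},\ldots,Z_{i_k})^\top$ (both are $0$ when $k=0$). LARS knots $\lambda_1\ge\lambda_2\ge\cdots$ and signed variables $\hat\imath_1,\hat\imath_2,\ldots\in[2p]$: for $k\ge1$, $\lambda_k=\max_{j:\,\theta_j(\hat\imath_1,\ldots,\hat\imath_{k-1})<1}\frac{Z_j-\Pi_{\hat\imath_1,\ldots,\hat\imath_{k-1}}(Z_j)}{1-\theta_j(\hat\imath_1,\ldots,\hat\imath_{k-1})}$ and $\hat\imath_k$ is the corresponding argmax. $\bar\imath_k\in[p]$ denotes the variable encoded by $\hat\imath_k$, $H_0=\{0\}$, $H_a=\mathrm{Span}(X_{\bar\imath_1},\ldots,X_{\bar\imath_a})$. By convention $\lambda_0=\infty$. A tuple $(i_1,\ldots,i_K)\in[2p]^K$ with pairwise different underlying variables satisfies the Irrepresentable Check if for all $k\in[K]$ the matrix $M_{i_1,\ldots,i_k}$ is invertible and $\theta_j(i_1,\ldots,i_k)<1$ for all $j\in[2p]\setminus\{i_1,\ldots,i_k\}$. Stopping rule: $\hat m$ is a random variable with values in $[K-1]$ (the value $0$ being allowed by convention) such that, for all $0\le a\le K-1$, $\mathbf 1_{\{\hat m\le a\}}$ is a measurable function of $(\lambda_1,\ldots,\lambda_a,\hat\imath_1,\ldots,\hat\imath_K)$. Scales: $\rho_1=\sqrt{R_{\hat\imath_1,\hat\imath_1}}$ and, for $2\le\ell\le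 K+1$, $\rho_\ell=\frac{\sqrt{R_{\hat\imath_\ell,\hat\imath_\ell}-(R_{\hat\imath_\ell,\hat\imath_1}\cdots R_{\hat\imath_\ell,\hat\imath_{\ell-1}})M^{-1}_{\hat\imath_1,\ldots,\hat\imath_{\ell-1}}(R_{\hat\imath_\ell,\hat\imath_1},\ldots,R_{\hat\imath_\ell,\hat\imath_{\ell-1}})^\top}}{1-\theta_{\hat\imath_\ell}(\hat\imath_1,\ldots,\hat\imath_{\ell-1})}$. With $\Phi$ the standard normal CDF, let $\Phi_i(x)=\Phi(x/(\sigma\rho_i))$, $F_i=\Phi_i(\lambda_i)$, $\mathcal P_{i,j}=\Phi_i\circ\Phi_j^{-1}$ for $i,j\in[K+1]$; by convention $F_0=1$ and $\mathcal P_{i,0}(F_0)=1$. For $0\le a<b$ define $$\mathcal I_{ab}(s,t)=\int_{\mathcal P_{a+1,b}(t)}^{\mathcal P_{a+1,a}(s)}df_{a+1}\int_{\mathcal P_{a+2,b}(t)}^{\mathcal P_{a+2,a+1}(f_{a+1})}df_{a+2}\cdots\int_{\mathcal P_{b-1,b}(t)}^{\mathcal P_{b-1,b-2}(f_{b-2})}df_{b-1},$$ with $\mathcal I_{ab}=1$ if $b=a+1$, and for $0\le a<b<c\le K+1$ $$\mathbb F_{abc}(t)=\mathbf 1_{\{\lambda_c\le t\le\lambda_a\}}\int_{\Phi_b(\lambda_c)}^{\Phi_b(t)}\mathcal I_{ab}(F_a,f_b)\,\mathcal I_{bc}(f_b,F_c)\,df_b.$$ *)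

theory Defs
  imports "HOL-Probability.Probability" "Jordan_Normal_Form.Gauss_Jordan_Elimination"
begin

text \<open>
  A signed index in \<open>[2p]\<close> is an element of \<^typ>\<open>'p + 'p\<close>: \<open>Inl j\<close> is \<open>j\<close> (variable \<open>j\<close>,
  sign \<open>+1\<close>) and \<open>Inr j\<close> is \<open>j + p\<close> (variable \<open>j\<close>, sign \<open>-1\<close>).
\<close>

definition variable_of :: "'p + 'p \<Rightarrow> 'p" where
  "variable_of = case_sum id id"

fun signed_vec :: "real ^ 'p \<Rightarrow> 'p + 'p \<Rightarrow> real" where
  "signed_vec z (Inl j) = vec_nth z j"
| "signed_vec z (Inr j) = - vec_nth z j"

definition signed_corr :: "real ^ 'p ^ 'n \<Rightarrow> real ^ 'n \<Rightarrow> 'p + 'p \<Rightarrow> real" where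
  "signed_corr X y = signed_vec (Finite_Cartesian_Product.transpose X *v y)"

fun signed_gram :: "real ^ 'p ^ 'n \<Rightarrow> 'p + 'p \<Rightarrow> 'p + 'p \<Rightarrow> real" where
  "signed_gram X (Inl i) (Inl j) = vec_nth (vec_nth (Finite_Cartesian_Product.transpose X ** X) i) j"
| "signed_gram X (Inl i) (Inr j) = - vec_nth (vec_nth (Finite_Cartesian_Product.transpose X ** X) i) j"
| "signed_gram X (Inr i) (Inl j) = - vec_nth (vec_nth (Finite_Cartesian_Product.transpose X ** X) i) j"
| "signed_gram X (Inr i) (Inr j) = vec_nth (vec_nth (Finite_Cartesian_Product.transpose X ** X) i) j"

definition sub_gram :: "real ^ 'p ^ 'n \<Rightarrow> ('p + 'p) list \<Rightarrow> real mat" where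
  "sub_gram X is = Matrix.mat (length is) (length is) (\<lambda>(a, b). signed_gram X (is ! a) (is ! b))"

definition cross_gram :: "real ^ 'p ^ 'n \<Rightarrow> 'p + 'p \<Rightarrow> ('p + 'p) list \<Rightarrow> real Matrix.vec" where
  "cross_gram X j is = Matrix.vec (length is) (\<lambda>a. signed_gram X j (is ! a))"

text \<open>
  The value for a singular matrix is immaterial for the mathematics.  With the zero matrix, the
  quantity \<open>theta\<close> below is odd in \<open>j\<close> even then, so the maximum defining a knot is
  always over a nonempty set.
\<close>

definition mat_inv :: "real mat \<Rightarrow> real mat" where
  "mat_inv A = (case mat_inverse A of Some B \<Rightarrow> B | None \<Rightarrow> 0\<^sub>m (dim_row A) (dim_row A))"

definition regress :: "real ^ 'p ^ 'n \<Rightarrow> ('p + 'p) list \<Rightarrow> 'p + 'p \<Rightarrow> real Matrix.vec \<Rightarrow> real" where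
  "regress X is j v = scalar_prod (cross_gram X j is) (mat_inv (sub_gram X is) *\<^sub>v v)"

definition theta :: "real ^ 'p ^ 'n \<Rightarrow> ('p + 'p) list \<Rightarrow> 'p + 'p \<Rightarrow> real" where
  "theta X is j = regress X is j (Matrix.vec (length is) (\<lambda>_. 1))"

definition proj_corr ::
    "real ^ 'p ^ 'n \<Rightarrow> ('p + 'p) list \<Rightarrow> ('p + 'p \<Rightarrow> real) \<Rightarrow> 'p + 'p \<Rightarrow> real" where
  "proj_corr X is z j = regress X is j (Matrix.vec (length is) (\<lambda>a. z (is ! a)))"

definition irrepresentable_check :: "real ^ 'p ^ 'n \<Rightarrow> ('p + 'p) list \<Rightarrow> bool" where
  "irrepresentable_check X is \<longleftrightarrow>
     distinct (map variable_of is) \<and>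
     (\<forall>k\<in>{1..length is}.
        invertible_mat (sub_gram X (take k is)) \<and>
        (\<forall>j. j \<notin> set (take k is) \<longrightarrow> theta X (take k is) j < 1))"

definition first_indices :: "(nat \<Rightarrow> 'p + 'p) \<Rightarrow> nat \<Rightarrow> ('p + 'p) list" where
  "first_indices idx k = map idx [1..<Suc k]"

definition lars_ratio ::
    "real ^ 'p ^ 'n \<Rightarrow> real ^ 'n \<Rightarrow> ('p + 'p) list \<Rightarrow> 'p + 'p \<Rightarrow> real" where
  "lars_ratio X y is j =
     (signed_corr X y j - proj_corr X is (signed_corr X y) j) / (1 - theta X is j)"

text \<open>
  \<open>lam\<close> and \<open>idx\<close> are the knots and signed variables of the first \<open>N\<close> LARS steps for the
  response \<open>y\<close>.  Ties in the argmax may be broken in any way.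
\<close>

definition lars_path ::
    "real ^ 'p ^ 'n \<Rightarrow> real ^ 'n \<Rightarrow> nat \<Rightarrow> (nat \<Rightarrow> ereal) \<Rightarrow> (nat \<Rightarrow> 'p + 'p) \<Rightarrow> bool" where
  "lars_path X y N lam idx \<longleftrightarrow>
     lam 0 = \<infinity> \<and>
     (\<forall>k\<in>{1..N}. let is = first_indices idx (k - 1) in
        lam k = ereal (Max (lars_ratio X y is ` {j. theta X is j < 1})) \<and>
        is_arg_max (lars_ratio X y is) (\<lambda>j. theta X is j < 1) (idx k))"

definition selected_span :: "real ^ 'p ^ 'n \<Rightarrow> (nat \<Rightarrow> 'p + 'p) \<Rightarrow> nat \<Rightarrow> (real ^ 'n) set" where
  "selected_span X idx a = span ((\<lambda>k. column (variable_of (idx k)) X) ` {1..a})"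

text \<open>For \<open>l = 1\<close> the formula reads \<open>sqrt (R\<^sub>i\<^sub>i)\<close> with \<open>i = idx 1\<close>.\<close>

definition rho :: "real ^ 'p ^ 'n \<Rightarrow> (nat \<Rightarrow> 'p + 'p) \<Rightarrow> nat \<Rightarrow> real" where
  "rho X idx l = (let is = first_indices idx (l - 1); j = idx l in
     sqrt (signed_gram X j j - regress X is j (cross_gram X j is)) / (1 - theta X is j))"

definition iso_normal_density :: "real \<Rightarrow> real ^ 'n \<Rightarrow> real" where
  "iso_normal_density \<sigma> y = (\<Prod>i\<in>UNIV. normal_density 0 \<sigma> (vec_nth y i))"

definition stopping_rule ::
    "'a measure \<Rightarrow> nat \<Rightarrow> ('a \<Rightarrow> nat \<Rightarrow> ereal) \<Rightarrow> ('a \<Rightarrow> nat \<Rightarrow> 'p + 'p) \<Rightarrow> ('a \<Rightarrow> nat) \<Rightarrow> bool" where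
  "stopping_rule M K lam idx mhat \<longleftrightarrow>
     (\<forall>\<omega>\<in>space M. mhat \<omega> \<le> K - 1) \<and>
     (\<forall>a\<le>K - 1. \<exists>g :: (nat \<Rightarrow> ereal) \<times> (nat \<Rightarrow> 'p + 'p) \<Rightarrow> real.
        g \<in> borel_measurable
              (PiM {1..a} (\<lambda>_. borel) \<Otimes>\<^sub>M PiM {1..K} (\<lambda>_. count_space UNIV)) \<and>
        (\<forall>\<omega>\<in>space M. (if mhat \<omega> \<le> a then 1 else 0) =
           g (restrict (lam \<omega>) {1..a}, restrict (idx \<omega>) {1..K})))"

text \<open>
  The standard normal distribution function on the extended reals, a bijection onto \<open>[0, 1]\<close>;
  its inverse therefore makes sense at the end points.
\<close>

definition std_normal_cdf :: "ereal \<Rightarrow> real" where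
  "std_normal_cdf x =
     (case x of ereal r \<Rightarrow> cdf std_normal_distribution r | PInfty \<Rightarrow> 1 | MInfty \<Rightarrow> 0)"

text \<open>In the following, \<open>\<tau> i\<close> is the standard deviation \<open>\<sigma> * \<rho>\<^sub>i\<close>.\<close>

definition Phi :: "(nat \<Rightarrow> real) \<Rightarrow> nat \<Rightarrow> ereal \<Rightarrow> real" where
  "Phi \<tau> i x = std_normal_cdf (x / ereal (\<tau> i))"

definition F_knot :: "(nat \<Rightarrow> real) \<Rightarrow> (nat \<Rightarrow> ereal) \<Rightarrow> nat \<Rightarrow> real" where
  "F_knot \<tau> lam i = (if i = 0 then 1 else Phi \<tau> i (lam i))"

text \<open>For \<open>j = 0\<close> this is only ever evaluated at \<open>F\<^sub>0 = 1\<close>.\<close>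

definition P_trans :: "(nat \<Rightarrow> real) \<Rightarrow> nat \<Rightarrow> nat \<Rightarrow> real \<Rightarrow> real" where
  "P_trans \<tau> i j f = (if j = 0 then 1 else Phi \<tau> i (inv_into UNIV (Phi \<tau> j) f))"

text \<open>
  The iterated integral, unfolded one integral at a time: the inner integrals over
  \<open>f\<^sub>a\<^sub>+\<^sub>2, \<dots>, f\<^sub>b\<^sub>-\<^sub>1\<close> are those for the index pair \<open>(a + 1, b)\<close> started at \<open>f = f\<^sub>a\<^sub>+\<^sub>1\<close>.
\<close>

function I_iter :: "(nat \<Rightarrow> real) \<Rightarrow> nat \<Rightarrow> nat \<Rightarrow> real \<Rightarrow> real \<Rightarrow> real" where
  "I_iter \<tau> a b s t =
     (if b \<le> a + 1 then 1
      else (LBINT f = P_trans \<tau> (a + 1) b t .. P_trans \<tau> (a + 1) a s. I_iter \<tau> (a + 1) b f t))"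
  by pat_completeness auto
termination by (relation "Wellfounded.measure (\<lambda>(\<tau>, a, b, s, t). b - a)") auto

declare I_iter.simps [simp del]

definition F_abc ::
    "(nat \<Rightarrow> real) \<Rightarrow> (nat \<Rightarrow> ereal) \<Rightarrow> nat \<Rightarrow> nat \<Rightarrow> nat \<Rightarrow> ereal \<Rightarrow> real" where
  "F_abc \<tau> lam a b c t =
     (if lam c \<le> t \<and> t \<le> lam a then 1 else 0) *
     (LBINT f = Phi \<tau> b (lam c) .. Phi \<tau> b t.
        I_iter \<tau> a b (F_knot \<tau> lam a) f * I_iter \<tau> b c f (F_knot \<tau> lam c))"

definition alpha_hat :: "(nat \<Rightarrow> real) \<Rightarrow> (nat \<Rightarrow> ereal) \<Rightarrow> nat \<Rightarrow> nat \<Rightarrow> nat \<Rightarrow> real" where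
  "alpha_hat \<tau> lam a b c = 1 - F_abc \<tau> lam a b c (lam b) / F_abc \<tau> lam a b c (lam a)"

end

theory Submission
  imports Defs
begin

text \<open>
  Fix a tuple \<open>i\<^sub>1, \<dots>, i\<^sub>K\<close> that passes the Irrepresentable Check and a model size \<open>a < K\<close>.  Let
  \<open>w\<^sub>k\<close> be the signed column of \<open>i\<^sub>k\<close> minus its projection onto the previous columns, divided by
  \<open>1 - \<theta>\<close>.  A path that selects the tuple has the knots \<open>\<lambda>\<^sub>k = w\<^sub>k \<bullet> y\<close>, and \<open>\<rho>\<^sub>k = \<parallel>w\<^sub>k\<parallel>\<close>; the \<open>w\<^sub>k\<close> are
  pairwise orthogonal, and the last knot \<open>\<Lambda>(y) = \<lambda>\<^sub>K\<^sub>+\<^sub>1\<close> depends only on the part of \<open>y\<close> orthogonal to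
  all of them.  Three ideas give the theorem.

  \<^item> \<^emph>\<open>The selection event is an ordering of knots.\<close>  At the value \<open>\<lambda>\<^sub>k\<close> the residual correlations are the same
    whether they are computed before or after \<open>i\<^sub>k\<close> joins the active set (\<open>lars_tie_transfer\<close>).  Hence a variable
    lies below \<open>\<lambda>\<^sub>k\<close> in one step if and only if it does so in the next one (\<open>lars_ratio_step\<close>), and, up
    to the null event of ties, the path selects the tuple if and only if
    \<open>w\<^sub>1 \<bullet> y > \<dots> > w\<^sub>K \<bullet> y > \<Lambda>(y)\<close> (\<open>lars_path_selected\<close>, \<open>lars_path_strict_selects\<close>).

  \<^item> \<^emph>\<open>Orthogonal coordinates can be integrated out one at a time.\<close>  If \<open>w\<close> is orthogonal to the mean of the
    Gaussian vector, replacing the coordinate along \<open>w\<close> by a fresh centred normal variable does not change its law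
    (\<open>nn_integral_shifted_iso_normal_resample\<close>).  Under the null hypothesis this applies to
    \<open>w\<^sub>a\<^sub>+\<^sub>1, \<dots>, w\<^sub>K\<close>.  Resampling \<open>w\<^sub>K\<close>, then \<open>w\<^sub>K\<^sub>-\<^sub>1\<close>, and so on, turns the ordering event into the nested
    integral \<open>nested_mass\<close> (\<open>nn_integral_descending\<close>).  So, given \<open>\<lambda>\<^sub>1, \<dots>, \<lambda>\<^sub>a\<close> and \<open>\<Lambda>\<close>, the knot
    \<open>\<lambda>\<^sub>a\<^sub>+\<^sub>1\<close> has on \<open>(\<Lambda>, \<lambda>\<^sub>a)\<close> a density proportional to the normal density times \<open>nested_mass\<close> of the
    remaining scales.

  \<^item> \<^emph>\<open>The statistic is a distribution function evaluated at its own variable.\<close>  Substituting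
    \<open>f = \<Phi>\<^sub>i(x)\<close> in the iterated integrals shows that the ratio in \<open>alpha_hat\<close> is the distribution function of this
    conditional law at \<open>\<lambda>\<^sub>a\<^sub>+\<^sub>1\<close> (\<open>alpha_hat_eq_nested_mass\<close>).  The conditional law has no
    atoms, so the ratio is uniform (\<open>nn_integral_descending_uniform\<close>).

  On the selection event the stopping rule makes \<open>mhat = a\<close> a condition on \<open>\<lambda>\<^sub>1, \<dots>, \<lambda>\<^sub>a\<close> alone, so it does not
  disturb the conditional law.  The conditioning event of the theorem is a finite disjoint union of
  events that fix the selected tuple and the value of \<open>mhat\<close>, and the statistic is uniform on each of them.
\<close>

no_notation Matrix.scalar_prod (infix "\<bullet>" 70)
no_notation Matrix.vec_index (infixl "$" 100)
hide_const (open) Matrix.orthogonal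

section \<open>The probability integral transform\<close>

abbreviation uniform01 :: "real measure" where
  "uniform01 \<equiv> density lborel (\<lambda>x. ennreal (indicator {0<..<1} x))"

lemma emeasure_uniform01: "A \<in> sets borel \<Longrightarrow> emeasure uniform01 A = emeasure lborel (A \<inter> {0<..<1})"
  by (simp add: emeasure_density ennreal_indicator indicator_inter_arith[symmetric] Int_commute)

lemma real_distribution_uniform01: "real_distribution uniform01"
proof -
  have "prob_space uniform01"
    by (rule prob_spaceI) (use emeasure_uniform01[of UNIV] in simp)
  then show ?thesis
    by (simp add: real_distribution_def real_distribution_axioms_def)
qed

lemma cdf_uniform01: "cdf uniform01 u = max 0 (min 1 u)"
proof -
  consider "u \<le> 0" | "0 < u" "u < 1" | "1 \<le> u" by linarith
  then show ?thesis
  proof cases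
    case 1
    then have "{..u} \<inter> {0<..<1} = {}" by auto
    with 1 show ?thesis by (simp add: cdf_def measure_def emeasure_uniform01)
  next
    case 2
    then have "{..u} \<inter> {0<..<1} = {0<..u}" by auto
    with 2 show ?thesis by (simp add: cdf_def measure_def emeasure_uniform01)
  next
    case 3
    then have "{..u} \<inter> {0<..<1} = {0<..<1}" by auto
    with 3 show ?thesis by (simp add: cdf_def measure_def emeasure_uniform01)
  qed
qed

lemma atomless_cdf_attains:
  assumes "real_distribution D" and atomless: "\<And>x. measure D {x} = 0"
    and u: "0 < u" "u < 1"
  shows "\<exists>b. cdf D b = u"
proof -
  interpret D: real_distribution D by fact
  have cont: "isCont (cdf D) x" for x
    by (simp add: D.isCont_cdf atomless)
  have "eventually (\<lambda>x. cdf D x < u) at_bot"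
    using order_tendstoD(2)[OF D.cdf_lim_at_bot u(1)] .
  then obtain l where l: "cdf D l < u" by (auto simp: eventually_at_bot_linorder)
  have "eventually (\<lambda>x. u < cdf D x) at_top"
    using order_tendstoD(1)[OF D.cdf_lim_at_top_prob u(2)] .
  then obtain r where r: "u < cdf D r" by (auto simp: eventually_at_top_linorder)
  have "l \<le> r" using l r D.cdf_nondecreasing[of r l] by linarith
  with l r show ?thesis
    using IVT'[of "cdf D" l u r] cont by (auto intro: continuous_at_imp_continuous_on)
qed

text \<open>
  The distribution function need not be strictly increasing, so the event \<open>cdf D x \<le> u\<close> is not of the form
  \<open>x \<le> b\<close> with an explicit \<open>b\<close>; it is squeezed between such half-lines, whose masses \<open>u\<close> and \<open>v > u\<close> are
  attained because there are no atoms.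
\<close>
lemma distr_cdf_eq_uniform01:
  assumes "real_distribution D" and atomless: "\<And>x. measure D {x} = 0"
  shows "distr D borel (cdf D) = uniform01"
proof -
  interpret D: real_distribution D by fact
  note hit = atomless_cdf_attains[OF assms]
  have [measurable]: "cdf D \<in> borel_measurable borel"
    by (intro borel_measurable_mono monoI D.cdf_nondecreasing)
  define G where "G u = measure D {x. cdf D x \<le> u}" for u
  have G_mono: "u \<le> v \<Longrightarrow> G u \<le> G v" for u v
    unfolding G_def by (intro D.finite_measure_mono) auto
  \<comment> \<open>Where the distribution function is flat, its sublevel set at \<open>u\<close> ends beyond the chosen point of level \<open>u\<close>, so a strictly larger level is needed.\<close>
  have upper: "G u \<le> v" if uv: "u < v" "0 < v" "v < 1" for u v
  proof -
    obtain b where b: "cdf D b = v" using hit uv by blast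
    have "{x. cdf D x \<le> u} \<subseteq> {..b}"
    proof
      fix x assume "x \<in> {x. cdf D x \<le> u}"
      then show "x \<in> {..b}" using D.cdf_nondecreasing[of b x] b uv by (cases "b \<le> x") auto
    qed
    then show ?thesis unfolding G_def using b
      by (metis D.finite_measure_mono D.sets_M cdf_def atMost_borel)
  qed
  have G_eq: "G u = max 0 (min 1 u)" for u
  proof -
    consider "u \<le> 0" | "0 < u" "u < 1" | "1 \<le> u" by linarith
    then show ?thesis
    proof cases
      case 1
      have "G u \<le> 0"
        by (rule dense_ge_bounded[of 0 1]) (use 1 in \<open>auto intro!: upper\<close>)
      moreover have "G u \<ge> 0" by (simp add: G_def)
      ultimately show ?thesis using 1 by simp
    next
      case 2
      have "G u \<le> u"
        by (rule dense_ge_bounded[of u 1]) (use 2 in \<open>auto intro!: upper\<close>)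
      moreover have "u \<le> G u"
      proof -
        obtain b where b: "cdf D b = u" using hit 2 by blast
        have "measure D {..b} \<le> G u" unfolding G_def
          using D.cdf_nondecreasing b by (intro D.finite_measure_mono) auto
        with b show ?thesis by (simp add: cdf_def)
      qed
      ultimately show ?thesis using 2 by simp
    next
      case 3
      have "{x. cdf D x \<le> u} = UNIV"
        using 3 D.cdf_bounded_prob order_trans by blast
      then show ?thesis using 3 D.prob_space by (simp add: G_def)
    qed
  qed
  show ?thesis
  proof (rule cdf_unique)
    show "real_distribution (distr D borel (cdf D))" by (rule D.real_distribution_distr) simp
    show "cdf (distr D borel (cdf D)) = cdf uniform01"
    proof
      fix u
      have "cdf (distr D borel (cdf D)) u = G u"
        unfolding cdf_def[of "distr _ _ _"] G_def by (subst measure_distr) (auto simp: vimage_def)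
      then show "cdf (distr D borel (cdf D)) u = cdf uniform01 u"
        by (simp add: G_eq cdf_uniform01)
    qed
  qed (rule real_distribution_uniform01)
qed

text \<open>The statistic is one minus a distribution function; the reflection restores the uniform law.\<close>
lemma emeasure_uniform01_reflect:
  assumes [measurable]: "B \<in> sets borel"
  shows "emeasure uniform01 {u. 1 - u \<in> B} = emeasure uniform01 B"
proof -
  have "emeasure uniform01 B = (\<integral>\<^sup>+u. indicator (B \<inter> {0<..<1}) u \<partial>lborel)"
    by (simp add: emeasure_uniform01)
  also have "\<dots> = (\<integral>\<^sup>+u. indicator (B \<inter> {0<..<1}) (1 + (-1) * u) \<partial>lborel)"
    by (subst nn_integral_real_affine[of _ "-1" 1]) auto
  also have "\<dots> = (\<integral>\<^sup>+u. indicator ({u. 1 - u \<in> B} \<inter> {0<..<1}) u \<partial>lborel)"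
    by (intro nn_integral_cong) (auto split: split_indicator)
  also have "\<dots> = emeasure uniform01 {u. 1 - u \<in> B}"
    by (subst emeasure_uniform01) auto
  finally show ?thesis by simp
qed

section \<open>Normal distribution functions on the extended reals\<close>

abbreviation centered_normal :: "real \<Rightarrow> real measure" where
  "centered_normal s \<equiv> density lborel (\<lambda>x. ennreal (normal_density 0 s x))"

lemma real_distribution_centered_normal:
  assumes "0 < s" shows "real_distribution (centered_normal s)"
  using prob_space_normal_density[OF assms, of 0]
  by (simp add: real_distribution_def real_distribution_axioms_def)

lemma emeasure_centered_normal_singleton: "emeasure (centered_normal s) {x} = 0"
  by (subst emeasure_density) (auto intro!: nn_integral_0_iff_AE[THEN iffD2] AE_I[where N="{x}"])

lemma cdf_centered_normal:
  assumes "0 < s"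
  shows "cdf (centered_normal s) x = cdf std_normal_distribution (x / s)"
proof -
  interpret P: prob_space std_normal_distribution
    by (rule prob_space_normal_density) simp
  have "distributed std_normal_distribution lborel (\<lambda>x. x) std_normal_density"
    by (simp add: distributed_def distr_id2)
  from P.normal_density_affine[OF this, of s 0] assms
  have "distr std_normal_distribution lborel (\<lambda>x. s * x) = centered_normal s"
    by (simp add: distributed_def)
  then have "cdf (centered_normal s) x = measure (distr std_normal_distribution lborel (\<lambda>x. s * x)) {..x}"
    by (simp add: cdf_def)
  also have "\<dots> = measure std_normal_distribution {z. s * z \<le> x}"
    by (subst measure_distr) (auto simp: vimage_def)
  also have "{z. s * z \<le> x} = {.. x / s}" using assms by (auto simp: field_simps)
  finally show ?thesis by (simp add: cdf_def)
qed

lemma cdf_std_normal_strict: "x < y \<Longrightarrow> cdf std_normal_distribution x < cdf std_normal_distribution y"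
proof -
  assume xy: "x < y"
  interpret P: real_distribution std_normal_distribution by (rule real_dist_normal_dist)
  have "emeasure std_normal_distribution {x<..y} \<noteq> 0"
  proof
    assume "emeasure std_normal_distribution {x<..y} = 0"
    then have "AE z in lborel. z \<notin> {x<..y}"
      by (subst (asm) emeasure_density, simp, simp, subst (asm) nn_integral_0_iff_AE, simp)
         (auto elim!: eventually_mono simp: normal_density_pos[THEN less_imp_neq, symmetric]
            split: split_indicator)
    then have "emeasure lborel {x<..y} = 0" 
      by (subst (asm) AE_iff_measurable[of "{x<..y}"]) auto
    then show False using xy by simp
  qed
  then have "measure std_normal_distribution {x<..y} > 0"
    by (simp add: P.emeasure_eq_measure zero_less_measure_iff)
  then show ?thesis using P.cdf_diff_eq[OF xy] by linarith
qed

lemma std_normal_cdf_strict_mono: "strict_mono std_normal_cdf"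
proof (rule strict_monoI)
  interpret P: real_distribution std_normal_distribution by (rule real_dist_normal_dist)
  have less1: "cdf std_normal_distribution r < 1" for r
    using cdf_std_normal_strict[of r "r+1"] P.cdf_bounded_prob[of "r+1"] by simp
  have pos: "0 < cdf std_normal_distribution r" for r
    using cdf_std_normal_strict[of "r-1" r] P.cdf_nonneg[of "r-1"] by simp
  show "x < y \<Longrightarrow> std_normal_cdf x < std_normal_cdf y" for x y
    by (cases x; cases y) (auto simp: std_normal_cdf_def less1 pos cdf_std_normal_strict)
qed

lemma std_normal_cdf_bounds: "0 \<le> std_normal_cdf x" "std_normal_cdf x \<le> 1"
proof -
  have "std_normal_cdf (-\<infinity>) = 0" "std_normal_cdf \<infinity> = 1"
    by (simp_all add: std_normal_cdf_def)
  then show "0 \<le> std_normal_cdf x" "std_normal_cdf x \<le> 1"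
    using strict_mono_less_eq[OF std_normal_cdf_strict_mono, of "-\<infinity>" x]
      strict_mono_less_eq[OF std_normal_cdf_strict_mono, of x \<infinity>] by simp_all
qed

lemma std_normal_cdf_surj:
  assumes "0 \<le> f" "f \<le> 1" shows "\<exists>x. std_normal_cdf x = f"
proof -
  consider "f = 0" | "f = 1" | "0 < f" "f < 1" using assms by linarith
  then show ?thesis
  proof cases
    case 1 then show ?thesis by (intro exI[of _ "-\<infinity>"]) (simp add: std_normal_cdf_def)
  next
    case 2 then show ?thesis by (intro exI[of _ "\<infinity>"]) (simp add: std_normal_cdf_def)
  next
    case 3
    have "measure std_normal_distribution {x} = 0" for x
      using emeasure_centered_normal_singleton[of 1 x] by (simp add: measure_def)
    then obtain x where "cdf std_normal_distribution x = f"
      using atomless_cdf_attains[OF real_dist_normal_dist] 3 by blast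
    then show ?thesis by (intro exI[of _ "ereal x"]) (simp add: std_normal_cdf_def)
  qed
qed

text \<open>
  The quotients \<open>x / ereal t\<close> include \<open>t = 0\<close>: a scale \<open>\<rho>\<^sub>i\<close> can vanish, and the statistic has to be a random variable
  there, too.
\<close>
lemma ereal_divide_ereal_cases:
  "x / ereal t = (case x of ereal r \<Rightarrow> (if t = 0 then (if r = 0 then 0 else if 0 < r then \<infinity> else -\<infinity>) else ereal (r / t))
     | PInfty \<Rightarrow> (if t < 0 then -\<infinity> else \<infinity>) | MInfty \<Rightarrow> (if t < 0 then \<infinity> else -\<infinity>))"
  by (cases x) (auto simp: divide_ereal_def divide_inverse)

lemma Phi_ereal: "0 < \<tau> i \<Longrightarrow> Phi \<tau> i (ereal x) = cdf (centered_normal (\<tau> i)) x"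
  by (subst cdf_centered_normal) (simp_all add: Phi_def std_normal_cdf_def)

lemma Phi_strict_mono: assumes "0 < \<tau> i" shows "strict_mono (Phi \<tau> i)"
  unfolding Phi_def
  by (intro strict_monoI strict_monoD[OF std_normal_cdf_strict_mono])
     (use assms in \<open>auto simp: ereal_divide_ereal_cases divide_strict_right_mono split: ereal.splits\<close>)

lemma inv_Phi: "0 < \<tau> i \<Longrightarrow> inv_into UNIV (Phi \<tau> i) (Phi \<tau> i x) = x"
  by (intro inv_f_f strict_mono_imp_inj_on Phi_strict_mono)

text \<open>
  Together with \<open>range_Phi_borel\<close> this makes \<open>P_trans\<close> measurable for scales of any sign: off the event of
  interest nothing is known about them.
\<close>
lemma Phi_mono_or_antimono: "mono (Phi \<tau> i) \<or> antimono (Phi \<tau> i)"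
proof (cases "0 \<le> \<tau> i")
  case True
  have "x / ereal (\<tau> i) \<le> y / ereal (\<tau> i)" if "x \<le> y" for x y
    using that True by (auto simp: ereal_divide_ereal_cases divide_right_mono divide_le_0_iff zero_le_divide_iff split: ereal.splits)
  then have "mono (Phi \<tau> i)"
    unfolding Phi_def by (intro monoI strict_mono_mono[OF std_normal_cdf_strict_mono, THEN monoD])
  then show ?thesis by simp
next
  case False
  have "y / ereal (\<tau> i) \<le> x / ereal (\<tau> i)" if "x \<le> y" for x y
    using that False by (auto simp: ereal_divide_ereal_cases divide_right_mono_neg divide_le_0_iff zero_le_divide_iff split: ereal.splits)
  then have "antimono (Phi \<tau> i)"
    unfolding Phi_def by (intro antimonoI strict_mono_mono[OF std_normal_cdf_strict_mono, THEN monoD])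
  then show ?thesis by simp
qed

lemma borel_measurable_Phi[measurable]: "Phi \<tau> i \<in> borel_measurable borel"
proof -
  have "std_normal_cdf \<in> borel_measurable borel"
  proof (rule borel_measurableI_less)
    fix c
    show "{x \<in> space borel. std_normal_cdf x < c} \<in> sets borel"
    proof -
      have "{x. std_normal_cdf x < c} = (if c \<le> 0 then {} else if 1 < c then UNIV
          else {..< (SOME x. std_normal_cdf x = c)})"
      proof -
        have "{x. std_normal_cdf x < c} = {..< (SOME x. std_normal_cdf x = c)}" if "0 \<le> c" "c \<le> 1"
        proof -
          have "std_normal_cdf (SOME x. std_normal_cdf x = c) = c"
            using std_normal_cdf_surj[OF that] by (rule someI_ex)
          then show ?thesis
            using strict_mono_less[OF std_normal_cdf_strict_mono, of _ "SOME x. std_normal_cdf x = c"] by auto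
        qed
        moreover have "{x. std_normal_cdf x < c} = {}" if "c \<le> 0"
          using that std_normal_cdf_bounds(1) order_trans by (auto simp: not_less)
        moreover have "{x. std_normal_cdf x < c} = UNIV" if "1 < c"
          using that std_normal_cdf_bounds(2) le_less_trans by auto
        ultimately show ?thesis by auto
      qed
      then show ?thesis by auto
    qed
  qed
  then show ?thesis unfolding Phi_def[abs_def] divide_ereal_def by measurable
qed

lemma range_Phi_borel: "range (Phi \<tau> i) \<in> sets borel"
proof (cases "\<tau> i = 0")
  case True
  have "range (Phi \<tau> i) \<subseteq> {std_normal_cdf 0, 0, 1}"
    using True by (auto simp: Phi_def ereal_divide_ereal_cases std_normal_cdf_def split: ereal.splits)
  then have "finite (range (Phi \<tau> i))" by (rule finite_subset) simp
  then show ?thesis by (rule sets.countable[OF _ countable_finite, rotated]) auto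
next
  case False
  have "range (Phi \<tau> i) = {0..1}"
  proof (intro equalityI subsetI)
    fix f assume "f \<in> range (Phi \<tau> i)"
    then show "f \<in> {0..1}" using std_normal_cdf_bounds by (auto simp: Phi_def)
  next
    fix f :: real assume "f \<in> {0..1}"
    then obtain z where z: "std_normal_cdf z = f" using std_normal_cdf_surj by auto
    have "z * ereal (\<tau> i) / ereal (\<tau> i) = z"
      using False by (cases z) (auto simp: ereal_divide_ereal_cases)
    with z have "Phi \<tau> i (z * ereal (\<tau> i)) = f" by (simp add: Phi_def)
    then show "f \<in> range (Phi \<tau> i)" by blast
  qed
  then show ?thesis by simp
qed

text \<open>
  On the range of \<open>Phi \<tau> j\<close> any choice of preimages is monotone or antimonotone, hence so is
  \<open>P_trans\<close>; off the range the inverse picks one fixed value, and \<open>P_trans\<close> is constant.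
\<close>
lemma borel_measurable_P_trans[measurable]: "P_trans \<tau> i j \<in> borel_measurable borel"
proof (cases "j = 0")
  case True then show ?thesis by (simp add: P_trans_def[abs_def])
next
  case False
  define R where "R = range (Phi \<tau> j)"
  define g where "g = inv_into UNIV (Phi \<tau> j)"
  have P: "P_trans \<tau> i j = Phi \<tau> i \<circ> g" using False by (simp add: P_trans_def[abs_def] g_def fun_eq_iff)
  have g: "Phi \<tau> j (g f) = f" if "f \<in> R" for f
    using that by (simp add: R_def g_def f_inv_into_f)
  have g_cases: "(\<forall>f\<in>R. \<forall>f'\<in>R. f \<le> f' \<longrightarrow> g f \<le> g f') \<or> (\<forall>f\<in>R. \<forall>f'\<in>R. f \<le> f' \<longrightarrow> g f' \<le> g f)"
    using Phi_mono_or_antimono[of \<tau> j]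
  proof
    assume m: "mono (Phi \<tau> j)"
    have "g f \<le> g f'" if "f \<in> R" "f' \<in> R" "f \<le> f'" for f f'
    proof (rule ccontr)
      assume "\<not> g f \<le> g f'"
      then have "g f' \<le> g f" by simp
      with m have "Phi \<tau> j (g f') \<le> Phi \<tau> j (g f)" by (rule monoD)
      with that have "f = f'" by (simp add: g)
      with \<open>\<not> g f \<le> g f'\<close> show False by simp
    qed
    then show ?thesis by blast
  next
    assume m: "antimono (Phi \<tau> j)"
    have "g f' \<le> g f" if "f \<in> R" "f' \<in> R" "f \<le> f'" for f f'
    proof (rule ccontr)
      assume "\<not> g f' \<le> g f"
      then have "g f \<le> g f'" by simp
      with m have "Phi \<tau> j (g f') \<le> Phi \<tau> j (g f)" by (rule antimonoD)
      with that have "f = f'" by (simp add: g)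
      with \<open>\<not> g f' \<le> g f\<close> show False by simp
    qed
    then show ?thesis by blast
  qed
  have "mono_on R (P_trans \<tau> i j) \<or> mono_on R (\<lambda>f. - P_trans \<tau> i j f)"
    using g_cases Phi_mono_or_antimono[of \<tau> i] unfolding P mono_on_def mono_def antimono_def by auto
  then have on_R: "P_trans \<tau> i j \<in> borel_measurable (restrict_space borel R)"
    using borel_measurable_mono_on_fnc[of R "P_trans \<tau> i j"]
      borel_measurable_mono_on_fnc[of R "\<lambda>f. - P_trans \<tau> i j f"] borel_measurable_uminus_eq by blast
  have "P_trans \<tau> i j f = Phi \<tau> i (SOME x. False)" if "f \<notin> R" for f
  proof -
    have "(\<lambda>x. Phi \<tau> j x = f) = (\<lambda>x. False)" using that by (auto simp: R_def)
    then show ?thesis by (simp add: P g_def inv_into_def)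
  qed
  then have off_R: "P_trans \<tau> i j \<in> borel_measurable (restrict_space borel (- R))"
    by (intro measurable_cong[THEN iffD2, OF _ measurable_const[of "Phi \<tau> i (SOME x. False)"]])
       (auto simp: space_restrict_space)
  show ?thesis
    by (rule measurable_piecewise_restrict[of "{R, - R}"])
       (use on_R off_R range_Phi_borel in \<open>auto simp: R_def\<close>)
qed

section \<open>Nested truncated Gaussian integrals\<close>

text \<open>Joint measurability in both end points is what makes the induction over the nested integrals work.\<close>
lemma borel_measurable_I_iter: 
  "(\<lambda>(s, t). I_iter \<tau> a b s t) \<in> borel_measurable (borel \<Otimes>\<^sub>M borel)"
proof (induction "b - a" arbitrary: a rule: less_induct)
  case less
  show ?case
  proof (cases "b \<le> a + 1")
    case True
    then have "I_iter \<tau> a b s t = 1" for s t by (subst I_iter.simps) simp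
    then show ?thesis by (simp add: case_prod_unfold)
  next
    case False
    note [measurable] = less[of "a + 1"]
    have [measurable]: "(\<lambda>(s, t). I_iter \<tau> (a + 1) b s t) \<in> borel_measurable (borel \<Otimes>\<^sub>M borel)"
      using False by (intro less) auto
    have [measurable]: "(\<lambda>x. I_iter \<tau> (a + 1) b (f x) (h x)) \<in> borel_measurable N"
      if [measurable]: "f \<in> borel_measurable N" "h \<in> borel_measurable N"
      for f h and N :: "((real \<times> real) \<times> real) measure"
      using measurable_compose[OF measurable_Pair[OF that] \<open>(\<lambda>(s, t). I_iter \<tau> (a + 1) b s t) \<in> _\<close>] by simp
    have "I_iter \<tau> a b s t
        = (LBINT f=P_trans \<tau> (a + 1) b t..P_trans \<tau> (a + 1) a s. I_iter \<tau> (a + 1) b f t)" for s t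
      using False by (subst I_iter.simps) simp
    note eq = this
    show ?thesis
      unfolding eq interval_lebesgue_integral_def set_lebesgue_integral_def einterval_def
        indicator_def case_prod_unfold real_scaleR_def mem_Collect_eq
      by measurable
  qed
qed

lemma borel_measurable_I_iter'[measurable (raw)]:
  assumes "f \<in> borel_measurable N" "h \<in> borel_measurable N"
  shows "(\<lambda>x. I_iter \<tau> a b (f x) (h x)) \<in> borel_measurable N"
  using measurable_compose[OF measurable_Pair[OF assms] borel_measurable_I_iter] by simp

text \<open>
  The mass that independent variables \<open>x\<^sub>j \<sim> N(0, s\<^sub>j\<^sup>2)\<close> give to \<open>u > x\<^sub>1 > \<dots> > x\<^sub>m > l\<close>.  The lower
  bound is tested only at the end of the list; an empty interval then has mass zero by itself
  (\<open>nested_mass_below\<close>).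
\<close>
fun nested_mass :: "real list \<Rightarrow> real \<Rightarrow> ereal \<Rightarrow> ennreal" where
  "nested_mass [] l u = (if ereal l < u then 1 else 0)"
| "nested_mass (s # ss) l u =
     (\<integral>\<^sup>+y. (if ereal y < u then nested_mass ss l (ereal y) else 0) \<partial>centered_normal s)"

lemma nested_mass_below: "u \<le> ereal l \<Longrightarrow> nested_mass ss l u = 0"
proof (induction ss arbitrary: u)
  case (Cons s ss)
  have "nested_mass ss l (ereal y) = 0" if "ereal y < u" for y
    using that Cons.prems by (intro Cons.IH) (auto dest: less_le_trans)
  then show ?case by (simp cong: if_cong)
qed auto

lemma borel_measurable_nested_mass:
  "(\<lambda>(l, u). nested_mass ss l u) \<in> borel_measurable (borel \<Otimes>\<^sub>M borel)"
proof (induction ss)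
  case (Cons s ss)
  have [measurable]: "(\<lambda>x. nested_mass ss (f x) (h x)) \<in> borel_measurable N"
      if "f \<in> borel_measurable N" "h \<in> borel_measurable N"
      for f h and N :: "((real \<times> ereal) \<times> real) measure"
      using measurable_compose[OF measurable_Pair[OF that] Cons.IH] by simp
  have sf: "sigma_finite_measure (centered_normal s)"
    by (simp add: sigma_finite_measure.sigma_finite_iff_density_finite[OF sigma_finite_lborel])
  show ?case
    unfolding nested_mass.simps case_prod_unfold
    by (rule sigma_finite_measure.borel_measurable_nn_integral[OF sf, of "\<lambda>x y. if ereal y < snd x then nested_mass ss (fst x) (ereal y) else 0"]) measurable
qed (simp add: case_prod_unfold)

lemma borel_measurable_nested_mass'[measurable (raw)]:
  assumes "f \<in> borel_measurable N" "h \<in> borel_measurable N"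
  shows "(\<lambda>x. nested_mass ss (f x) (h x)) \<in> borel_measurable N"
  using measurable_compose[OF measurable_Pair[OF assms] borel_measurable_nested_mass] by simp

lemma nested_mass_le_1:
  assumes "\<And>s. s \<in> set ss \<Longrightarrow> 0 < s" shows "nested_mass ss l u \<le> 1"
  using assms
proof (induction ss arbitrary: u)
  case (Cons s ss)
  interpret real_distribution "centered_normal s"
    by (rule real_distribution_centered_normal) (use Cons in simp)
  have "nested_mass (s # ss) l u \<le> (\<integral>\<^sup>+y. 1 \<partial>centered_normal s)"
    unfolding nested_mass.simps using Cons by (intro nn_integral_mono) auto
  then show ?case by (simp add: emeasure_space_1[simplified])
qed simp

text \<open>
  One integral of \<open>I_iter\<close>, after the substitution \<open>f = \<Phi>\<^sub>b(y)\<close>.  The substitution is the probability integral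
  transform: \<open>\<Phi>\<^sub>b\<close> maps the centred normal law to the uniform law.  In this form an upper end \<open>x = \<infinity>\<close> is harmless.
\<close>
lemma interval_integral_Phi:
  fixes m :: "ereal \<Rightarrow> ennreal"
  assumes t: "0 < \<tau> b" and lx: "ereal l \<le> x"
    and [measurable]: "g \<in> borel_measurable borel" "m \<in> borel_measurable borel"
    and g: "\<And>y. l < y \<Longrightarrow> g (Phi \<tau> b (ereal y)) = enn2real (m (ereal y))"
    and below: "\<And>y. y \<le> l \<Longrightarrow> m (ereal y) = 0" and fin: "\<And>y. m y < \<infinity>"
  shows "(LBINT f=Phi \<tau> b (ereal l)..Phi \<tau> b x. g f)
       = enn2real (\<integral>\<^sup>+y. (if ereal y < x then m (ereal y) else 0) \<partial>centered_normal (\<tau> b))"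
proof -
  define N where "N = centered_normal (\<tau> b)"
  interpret N: real_distribution N
    unfolding N_def by (rule real_distribution_centered_normal) fact
  have sN[measurable_cong]: "sets N = sets borel" by (simp add: N_def)
  have cdfN: "cdf N = (\<lambda>y. Phi \<tau> b (ereal y))" using t by (simp add: N_def Phi_ereal fun_eq_iff)
  have unif: "uniform01 = distr N borel (\<lambda>y. Phi \<tau> b (ereal y))"
    unfolding cdfN[symmetric]
    by (rule distr_cdf_eq_uniform01[symmetric, OF N.real_distribution_axioms])
       (simp add: N_def measure_def emeasure_centered_normal_singleton)
  have less: "Phi \<tau> b u < Phi \<tau> b v \<longleftrightarrow> u < v" for u v
    using strict_mono_less[of "Phi \<tau> b"] Phi_strict_mono[of \<tau> b] t by blast
  have le: "Phi \<tau> b u \<le> Phi \<tau> b v \<longleftrightarrow> u \<le> v" for u v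
    using strict_mono_less_eq[of "Phi \<tau> b"] Phi_strict_mono[of \<tau> b] t by blast
  define I where "I = {Phi \<tau> b (ereal l)<..<Phi \<tau> b x}"
  have "I \<subseteq> {0<..<1}"
  proof
    fix f assume "f \<in> I"
    moreover have "0 \<le> Phi \<tau> b (ereal l)" "Phi \<tau> b x \<le> 1" by (simp_all add: Phi_def std_normal_cdf_bounds)
    ultimately show "f \<in> {0<..<1}" by (auto simp: I_def)
  qed
  then have I: "indicator I f = (indicator {0<..<1} f :: real) * indicator I f" for f
    by (auto split: split_indicator)
  have "(LBINT f=Phi \<tau> b (ereal l)..Phi \<tau> b x. g f) = (\<integral>f. indicator I f * g f \<partial>lborel)"
    using lx by (simp add: interval_lebesgue_integral_def set_lebesgue_integral_def le I_def einterval_eq)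
  also have "\<dots> = (\<integral>f. indicator {0<..<1} f *\<^sub>R (indicator I f * g f) \<partial>lborel)"
    by (subst I) (simp add: mult.assoc)
  also have "\<dots> = (\<integral>f. indicator I f * g f \<partial>uniform01)"
    by (subst integral_density) (auto simp: I_def)
  also have "\<dots> = (\<integral>y. indicator I (Phi \<tau> b (ereal y)) * g (Phi \<tau> b (ereal y)) \<partial>N)"
    unfolding unif by (subst integral_distr) (auto simp: I_def)
  also have "\<dots> = (\<integral>y. enn2real (if ereal y < x then m (ereal y) else 0) \<partial>N)"
    by (intro Bochner_Integration.integral_cong refl)
       (auto simp: I_def less g below not_less split: split_indicator)
  also have "\<dots> = enn2real (\<integral>\<^sup>+y. ennreal (enn2real (if ereal y < x then m (ereal y) else 0)) \<partial>N)"
    by (rule integral_eq_nn_integral) auto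
  also have "\<dots> = enn2real (\<integral>\<^sup>+y. (if ereal y < x then m (ereal y) else 0) \<partial>N)"
    using fin by (intro arg_cong[where f=enn2real] nn_integral_cong) (auto simp: less_top[symmetric])
  finally show ?thesis by (simp add: N_def)
qed

text \<open>
  The scale \<open>\<tau> c\<close> enters only through the inverse of \<open>Phi \<tau> c\<close> at \<open>T\<close>, so it may be degenerate as long as that
  value is the right one.
\<close>
lemma I_iter_eq_nested_mass:
  assumes "1 \<le> k" "k < c" and pos: "\<And>i. i \<in> {1..<c} \<Longrightarrow> 0 < \<tau> i"
    and T: "inv_into UNIV (Phi \<tau> c) T = ereal l" and "l < y"
  shows "I_iter \<tau> k c (Phi \<tau> k (ereal y)) T = enn2real (nested_mass (map \<tau> [Suc k..<c]) l (ereal y))"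
  using assms(1,2,5)
proof (induction "c - k" arbitrary: k y rule: less_induct)
  case less
  show ?case
  proof (cases "c \<le> k + 1")
    case True
    with less.prems show ?thesis by (subst I_iter.simps) simp
  next
    case False
    have "I_iter \<tau> k c (Phi \<tau> k (ereal y)) T
        = (LBINT f=Phi \<tau> (k + 1) (ereal l)..Phi \<tau> (k + 1) (ereal y). I_iter \<tau> (k + 1) c f T)"
      using less.prems False by (subst I_iter.simps) (simp add: P_trans_def inv_Phi pos T)
    also have "\<dots> = enn2real (\<integral>\<^sup>+z. (if ereal z < ereal y then
          nested_mass (map \<tau> [Suc (k + 1)..<c]) l (ereal z) else 0) \<partial>centered_normal (\<tau> (k + 1)))"
    proof (rule interval_integral_Phi)
      show "I_iter \<tau> (k + 1) c (Phi \<tau> (k + 1) (ereal z)) T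
          = enn2real (nested_mass (map \<tau> [Suc (k + 1)..<c]) l (ereal z))" if "l < z" for z
        using that less.prems False by (intro less.hyps) auto
      show "nested_mass (map \<tau> [Suc (k + 1)..<c]) l z < \<infinity>" for z
        by (rule le_less_trans[OF nested_mass_le_1]) (auto intro!: pos)
    qed (use less.prems False pos in \<open>auto intro: nested_mass_below\<close>)
    also have "\<dots> = enn2real (nested_mass (map \<tau> [Suc k..<c]) l (ereal y))"
    proof -
      have "[Suc k..<c] = (k + 1) # [Suc (k + 1)..<c]" using False by (simp add: upt_conv_Cons)
      then show ?thesis by (simp del: upt.simps less_ereal.simps cong: if_cong)
    qed
    finally show ?thesis .
  qed
qed

lemma outer_integral_eq_nested_mass:
  assumes b: "1 \<le> b" "b < c" and pos: "\<And>i. i \<in> {1..<c} \<Longrightarrow> 0 < \<tau> i"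
    and T: "inv_into UNIV (Phi \<tau> c) T = ereal l" and "ereal l \<le> x"
  shows "(LBINT f=Phi \<tau> b (ereal l)..Phi \<tau> b x. I_iter \<tau> b c f T)
       = enn2real (nested_mass (map \<tau> [b..<c]) l x)"
proof -
  have "(LBINT f=Phi \<tau> b (ereal l)..Phi \<tau> b x. I_iter \<tau> b c f T)
      = enn2real (\<integral>\<^sup>+z. (if ereal z < x then
          nested_mass (map \<tau> [Suc b..<c]) l (ereal z) else 0) \<partial>centered_normal (\<tau> b))"
  proof (rule interval_integral_Phi)
    show "nested_mass (map \<tau> [Suc b..<c]) l z < \<infinity>" for z
      by (rule le_less_trans[OF nested_mass_le_1]) (auto intro!: pos)
  qed (use assms I_iter_eq_nested_mass[of b c \<tau> T l] in \<open>auto intro: nested_mass_below\<close>)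
  moreover have "[b..<c] = b # [Suc b..<c]" using b by (simp add: upt_conv_Cons)
  ultimately show ?thesis by (simp del: upt.simps)
qed

text \<open>
  The density \<open>nested_mass ss l\<close> on \<open>(l, u)\<close> relative to the centred normal law has the distribution function
  \<open>x \<mapsto> nested_mass (s # ss) l x\<close> and the total mass \<open>nested_mass (s # ss) l u\<close>.  Normalised, it has no
  atoms, so its distribution function is uniform under it.  If the total mass is zero both sides vanish.
\<close>
lemma nested_mass_probability_integral_transform:
  assumes s: "0 < s" and ss: "\<And>r. r \<in> set ss \<Longrightarrow> 0 < r" and [measurable]: "B \<in> sets borel"
  shows "(\<integral>\<^sup>+y. indicator B (1 - enn2real (nested_mass (s # ss) l (ereal y)) / enn2real (nested_mass (s # ss) l u))
            * (if ereal y < u then nested_mass ss l (ereal y) else 0) \<partial>centered_normal s)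
       = emeasure uniform01 B * nested_mass (s # ss) l u"
proof -
  define N where "N = centered_normal s"
  interpret N: real_distribution N
    unfolding N_def by (rule real_distribution_centered_normal) fact
  have sN[measurable_cong]: "sets N = sets borel" by (simp add: N_def)
  define d where "d y = (if ereal y < u then nested_mass ss l (ereal y) else 0)" for y
  have [measurable]: "d \<in> borel_measurable borel" unfolding d_def[abs_def] by measurable
  define m where "m = nested_mass (s # ss) l u"
  have m: "m = (\<integral>\<^sup>+y. d y \<partial>N)" by (simp add: m_def d_def N_def)
  have "m \<le> 1" unfolding m_def by (rule nested_mass_le_1) (use s ss in auto)
  then have m_fin: "m < \<infinity>" by (simp add: le_less_trans)
  show ?thesis
  proof (cases "m = 0")
    case True
    then have "AE y in N. d y = 0" by (simp add: m nn_integral_0_iff_AE)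
    then have "(\<integral>\<^sup>+y. indicator B (1 - enn2real (nested_mass (s # ss) l (ereal y)) / enn2real m) * d y \<partial>N) = (\<integral>\<^sup>+y. 0 \<partial>N)"
      by (intro nn_integral_cong_AE) (auto elim: eventually_mono)
    with True show ?thesis by (simp add: d_def N_def m_def)
  next
    case False
    define D where "D = density N (\<lambda>y. d y / m)"
    have emD: "emeasure D A = (\<integral>\<^sup>+y. d y * indicator A y \<partial>N) / m" if [measurable]: "A \<in> sets borel" for A
    proof -
      have "emeasure D A = (\<integral>\<^sup>+y. d y / m * indicator A y \<partial>N)"
        unfolding D_def by (rule emeasure_density) auto
      also have "\<dots> = (\<integral>\<^sup>+y. d y * indicator A y / m \<partial>N)"
        by (intro nn_integral_cong) (simp add: divide_ennreal_def mult_ac)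
      finally show ?thesis by (simp add: nn_integral_divide)
    qed
    have sD[measurable_cong]: "sets D = sets borel" by (simp add: D_def)
    have "emeasure D (space D) = 1"
      using False m_fin emD[of UNIV] sets_eq_imp_space_eq[OF sD] by (simp add: m[symmetric] ennreal_divide_self)
    then interpret D: real_distribution D
      by (simp add: real_distribution_def real_distribution_axioms_def sD prob_spaceI)
    have no_atom: "AE y in N. y \<noteq> z" for z
      by (rule AE_I[of _ _ "{z}"]) (auto simp: N_def emeasure_centered_normal_singleton)
    have atomless: "measure D {z} = 0" for z
    proof -
      have "(\<integral>\<^sup>+y. d y * indicator {z} y \<partial>N) = (\<integral>\<^sup>+y. 0 \<partial>N)"
        using no_atom[of z] by (intro nn_integral_cong_AE) (auto elim: eventually_mono)
      then have "emeasure D {z} = 0" by (subst emD) simp_all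
      then show ?thesis by (simp add: measure_def)
    qed
    have cdfD: "cdf D z = enn2real (nested_mass (s # ss) l (ereal z)) / enn2real m" if "ereal z < u" for z
    proof -
      have u: "ereal y < u" if "y \<le> z" for y
        using \<open>ereal z < u\<close> that le_less_trans[of "ereal y" "ereal z" u] by simp
      have "(\<integral>\<^sup>+y. d y * indicator {..z} y \<partial>N) = nested_mass (s # ss) l (ereal z)"
        unfolding nested_mass.simps N_def[symmetric]
        using no_atom[of z]
        by (intro nn_integral_cong_AE)
           (auto elim!: eventually_mono simp: d_def u split: split_indicator)
      moreover have "enn2real (a / m) = enn2real a / enn2real m" if "a \<le> 1" for a
      proof -
        obtain q where "a = ennreal q" "0 \<le> q" using \<open>a \<le> 1\<close> by (cases a) (auto simp: top_unique)
        moreover obtain r where "m = ennreal r" "0 < r"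
          using m_fin False by (cases m) (auto simp: less_le)
        ultimately show ?thesis by (simp add: divide_ennreal)
      qed
      moreover have "nested_mass (s # ss) l (ereal z) \<le> 1"
        by (rule nested_mass_le_1) (use s ss in auto)
      ultimately show ?thesis by (simp add: cdf_def measure_def emD del: nested_mass.simps)
    qed
    have [measurable]: "cdf D \<in> borel_measurable borel"
      by (intro borel_measurable_mono monoI D.cdf_nondecreasing)
    have "(\<integral>\<^sup>+y. indicator B (1 - enn2real (nested_mass (s # ss) l (ereal y)) / enn2real m) * d y \<partial>N)
        = (\<integral>\<^sup>+y. m * (d y / m * indicator B (1 - cdf D y)) \<partial>N)"
    proof (intro nn_integral_cong)
      fix y
      have "m * (d y / m) = d y"
        using False m_fin by (metis ennreal_times_divide ennreal_mult_divide_eq infinity_ennreal_def less_irrefl mult.commute)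
      then show "indicator B (1 - enn2real (nested_mass (s # ss) l (ereal y)) / enn2real m) * d y
          = m * (d y / m * indicator B (1 - cdf D y))"
        by (cases "ereal y < u") (simp_all add: cdfD d_def mult.assoc[symmetric] mult.commute)
    qed
    also have "\<dots> = m * (\<integral>\<^sup>+y. d y / m * indicator B (1 - cdf D y) \<partial>N)"
      by (rule nn_integral_cmult) measurable
    also have "(\<integral>\<^sup>+y. d y / m * indicator B (1 - cdf D y) \<partial>N) = (\<integral>\<^sup>+y. indicator B (1 - cdf D y) \<partial>D)"
    proof -
      define C where "C = cdf D"
      have [measurable]: "C \<in> borel_measurable borel" by (simp add: C_def)
      show ?thesis unfolding C_def[symmetric] unfolding D_def by (rule nn_integral_density[symmetric]) measurable
    qed
    also have "(\<integral>\<^sup>+y. indicator B (1 - cdf D y) \<partial>D) = (\<integral>\<^sup>+v. indicator {v. 1 - v \<in> B} v \<partial>distr D borel (cdf D))"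
      by (subst nn_integral_distr) (auto simp: indicator_def)
    also have "\<dots> = emeasure uniform01 B"
      using distr_cdf_eq_uniform01[OF D.real_distribution_axioms atomless]
      by (simp add: emeasure_uniform01_reflect)
    finally show ?thesis by (simp add: d_def N_def m_def mult.commute)
  qed
qed

section \<open>Resampling a Gaussian vector along one direction\<close>

abbreviation iso_normal :: "real \<Rightarrow> (real ^ 'n) measure" where
  "iso_normal \<sigma> \<equiv> density lborel (\<lambda>y. ennreal (iso_normal_density \<sigma> y))"

text \<open>The coordinate of \<open>y\<close> along \<open>w\<close> is moved to \<open>x\<close>; the part of \<open>y\<close> orthogonal to \<open>w\<close> is kept.\<close>
definition resample :: "real ^ 'n \<Rightarrow> real \<Rightarrow> real ^ 'n \<Rightarrow> real ^ 'n" where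
  "resample w x y = y + ((x - w \<bullet> y) / (w \<bullet> w)) *\<^sub>R w"

lemma inner_resample_self: "w \<noteq> 0 \<Longrightarrow> w \<bullet> resample w x y = x"
  by (simp add: resample_def inner_add_right)

lemma inner_resample_orthogonal: "v \<bullet> w = 0 \<Longrightarrow> v \<bullet> resample w x y = v \<bullet> y"
  by (simp add: resample_def inner_add_right)

lemma iso_normal_density_nonneg: "0 \<le> iso_normal_density \<sigma> y"
  by (simp add: iso_normal_density_def prod_nonneg)

lemma borel_measurable_iso_normal_density[measurable]: 
  "iso_normal_density \<sigma> \<in> borel_measurable borel"
  unfolding iso_normal_density_def[abs_def] by measurable

lemma iso_normal_density_eq_exp:
  "iso_normal_density \<sigma> (y :: real ^ 'n) = (1 / sqrt (2 * pi * \<sigma>\<^sup>2)) ^ CARD('n) * exp (- (y \<bullet> y) / (2 * \<sigma>\<^sup>2))"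
  by (simp add: iso_normal_density_def normal_density_def prod.distrib exp_sum[symmetric]
        inner_vec_def sum_divide_distrib[symmetric] sum_negf power2_eq_square prod_dividef power_divide)

text \<open>
  Both sides are Gaussian in \<open>(y, t)\<close>; the exponents agree by Pythagoras, since a shift along \<open>w\<close> changes only
  the coordinate \<open>w \<bullet> y\<close> and \<open>w \<bullet> y\<close> has the scale \<open>\<sigma> * norm w\<close>.
\<close>
lemma iso_normal_density_shift:
  assumes "0 < \<sigma>" "w \<noteq> (0 :: real ^ 'n)"
  shows "iso_normal_density \<sigma> (y - (t / (w \<bullet> w)) *\<^sub>R w) * normal_density 0 (\<sigma> * norm w) (w \<bullet> y)
       = iso_normal_density \<sigma> y * normal_density 0 (\<sigma> * norm w) (w \<bullet> y - t)"
proof -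
  have ww: "w \<bullet> w \<noteq> 0" "(norm w)\<^sup>2 = w \<bullet> w" using assms by (simp_all add: power2_norm_eq_inner)
  have "(y - (t / (w \<bullet> w)) *\<^sub>R w) \<bullet> (y - (t / (w \<bullet> w)) *\<^sub>R w) + (w \<bullet> y)\<^sup>2 / (w \<bullet> w)
      = y \<bullet> y + (w \<bullet> y - t)\<^sup>2 / (w \<bullet> w)"
    using ww by (simp add: inner_diff_left inner_diff_right inner_commute[of y w] power2_eq_square field_simps)
  then have "exp (- ((y - (t / (w \<bullet> w)) *\<^sub>R w) \<bullet> (y - (t / (w \<bullet> w)) *\<^sub>R w)) / (2 * \<sigma>\<^sup>2))
        * exp (- (w \<bullet> y)\<^sup>2 / (2 * (\<sigma> * norm w)\<^sup>2))
      = exp (- (y \<bullet> y) / (2 * \<sigma>\<^sup>2)) * exp (- (w \<bullet> y - t)\<^sup>2 / (2 * (\<sigma> * norm w)\<^sup>2))"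
    using assms ww unfolding exp_add[symmetric] power_mult_distrib
    by (intro arg_cong[where f=exp]) (simp add: field_simps)
  then show ?thesis
    by (simp add: iso_normal_density_eq_exp normal_density_def)
qed

lemma nn_integral_lborel_translate:
  fixes c :: "'b::euclidean_space"
  assumes [measurable]: "f \<in> borel_measurable borel"
  shows "(\<integral>\<^sup>+y. f (c + y) \<partial>lborel) = (\<integral>\<^sup>+y. f y \<partial>lborel)"
proof -
  have "(\<integral>\<^sup>+y. f y \<partial>lborel) = (\<integral>\<^sup>+y. f y \<partial>distr lborel borel ((+) c))"
    by (simp add: lborel_distr_plus)
  then show ?thesis by (simp add: nn_integral_distr)
qed

lemma borel_measurable_resample[measurable (raw)]:
  assumes [measurable]: "f \<in> borel_measurable N" "g \<in> borel_measurable N"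
  shows "(\<lambda>z. resample w (f z) (g z)) \<in> borel_measurable N"
  unfolding resample_def by measurable

text \<open>
  This is the independence of the coordinate along \<open>w\<close> from the orthogonal part.  It follows from Tonelli's theorem
  and the translation invariance of Lebesgue measure, without a rotation of the axes: shift \<open>x\<close> by
  \<open>w \<bullet> y\<close>, exchange the integrals, shift \<open>y\<close> back along \<open>w\<close>, use \<open>iso_normal_density_shift\<close>, and
  integrate out the shift.
\<close>
lemma nn_integral_iso_normal_resample:
  fixes h :: "real ^ 'n \<Rightarrow> ennreal"
  assumes [measurable]: "h \<in> borel_measurable borel" and \<sigma>: "0 < \<sigma>" and w: "w \<noteq> 0"
  shows "(\<integral>\<^sup>+y. \<integral>\<^sup>+x. h (resample w x y) \<partial>centered_normal (\<sigma> * norm w) \<partial>iso_normal \<sigma>)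
       = (\<integral>\<^sup>+y. h y \<partial>iso_normal \<sigma>)"
proof -
  have psf: "pair_sigma_finite (lborel :: real measure) (lborel :: (real ^ 'n) measure)"
    by (intro pair_sigma_finite.intro sigma_finite_lborel)
  define f where "f y = ennreal (iso_normal_density \<sigma> y)" for y :: "real ^ 'n"
  define n where "n x = ennreal (normal_density 0 (\<sigma> * norm w) x)" for x
  define d where "d t = (t / (w \<bullet> w)) *\<^sub>R w" for t
  have [measurable]: "f \<in> borel_measurable borel" "n \<in> borel_measurable borel" "d \<in> borel_measurable borel"
    by (simp_all add: f_def[abs_def] n_def[abs_def] d_def[abs_def])
  have wd: "w \<bullet> d t = t" for t using w by (simp add: d_def)
  have shift: "f (y - d t) * n (w \<bullet> y) = f y * n (w \<bullet> y - t)" for y t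
    using iso_normal_density_shift[OF \<sigma> w, of y t]
    by (simp add: f_def n_def d_def ennreal_mult[symmetric] iso_normal_density_nonneg)
  have total: "(\<integral>\<^sup>+t. n (c - t) \<partial>lborel) = 1" for c
  proof -
    have "(\<integral>\<^sup>+t. n (c - t) \<partial>lborel) = (\<integral>\<^sup>+t. n t \<partial>lborel)"
      by (subst (2) nn_integral_real_affine[of _ "-1" c]) simp_all
    also have "\<dots> = emeasure (centered_normal (\<sigma> * norm w)) (space (centered_normal (\<sigma> * norm w)))"
      by (simp add: n_def emeasure_density)
    also have "\<dots> = 1"
      using \<sigma> w by (intro prob_space.emeasure_space_1 prob_space_normal_density) simp
    finally show ?thesis .
  qed
  have "(\<integral>\<^sup>+y. \<integral>\<^sup>+x. h (resample w x y) \<partial>centered_normal (\<sigma> * norm w) \<partial>iso_normal \<sigma>)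
      = (\<integral>\<^sup>+y. f y * (\<integral>\<^sup>+x. n x * h (resample w x y) \<partial>lborel) \<partial>lborel)"
    by (simp add: nn_integral_density f_def n_def)
  also have "\<dots> = (\<integral>\<^sup>+y. \<integral>\<^sup>+t. f y * (n (w \<bullet> y + t) * h (y + d t)) \<partial>lborel \<partial>lborel)"
  proof (rule nn_integral_cong)
    fix y
    have "(\<integral>\<^sup>+x. n x * h (resample w x y) \<partial>lborel) = (\<integral>\<^sup>+t. n (w \<bullet> y + t) * h (resample w (w \<bullet> y + t) y) \<partial>lborel)"
      by (rule nn_integral_lborel_translate[symmetric]) measurable
    also have "\<dots> = (\<integral>\<^sup>+t. n (w \<bullet> y + t) * h (y + d t) \<partial>lborel)"
      by (simp add: resample_def d_def)
    finally show "f y * (\<integral>\<^sup>+x. n x * h (resample w x y) \<partial>lborel)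
        = (\<integral>\<^sup>+t. f y * (n (w \<bullet> y + t) * h (y + d t)) \<partial>lborel)"
      by (simp add: nn_integral_cmult)
  qed
  also have "\<dots> = (\<integral>\<^sup>+t. \<integral>\<^sup>+y. f y * (n (w \<bullet> y + t) * h (y + d t)) \<partial>lborel \<partial>lborel)"
    by (rule pair_sigma_finite.Fubini'[OF psf]) measurable
  also have "\<dots> = (\<integral>\<^sup>+t. \<integral>\<^sup>+y. f y * n (w \<bullet> y - t) * h y \<partial>lborel \<partial>lborel)"
  proof (rule nn_integral_cong)
    fix t
    have "(\<integral>\<^sup>+y. f y * (n (w \<bullet> y + t) * h (y + d t)) \<partial>lborel)
        = (\<integral>\<^sup>+y. f (- d t + y) * (n (w \<bullet> (- d t + y) + t) * h (- d t + y + d t)) \<partial>lborel)"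
      by (rule nn_integral_lborel_translate[symmetric]) measurable
    also have "\<dots> = (\<integral>\<^sup>+y. f (y - d t) * n (w \<bullet> y) * h y \<partial>lborel)"
      by (simp add: inner_diff_right inner_add_right wd mult.assoc)
    finally show "(\<integral>\<^sup>+y. f y * (n (w \<bullet> y + t) * h (y + d t)) \<partial>lborel)
        = (\<integral>\<^sup>+y. f y * n (w \<bullet> y - t) * h y \<partial>lborel)"
      by (simp add: shift)
  qed
  also have "\<dots> = (\<integral>\<^sup>+y. \<integral>\<^sup>+t. f y * n (w \<bullet> y - t) * h y \<partial>lborel \<partial>lborel)"
    by (rule pair_sigma_finite.Fubini'[OF psf, symmetric]) measurable
  also have "\<dots> = (\<integral>\<^sup>+y. f y * h y \<partial>lborel)"
  proof (rule nn_integral_cong)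
    fix y
    have "(\<integral>\<^sup>+t. f y * n (w \<bullet> y - t) * h y \<partial>lborel) = (\<integral>\<^sup>+t. (f y * h y) * n (w \<bullet> y - t) \<partial>lborel)"
      by (simp add: mult_ac)
    also have "\<dots> = f y * h y" by (subst nn_integral_cmult) (simp_all add: total)
    finally show "(\<integral>\<^sup>+t. f y * n (w \<bullet> y - t) * h y \<partial>lborel) = f y * h y" .
  qed
  also have "\<dots> = (\<integral>\<^sup>+y. h y \<partial>iso_normal \<sigma>)"
    by (simp add: nn_integral_density f_def)
  finally show ?thesis .
qed

lemma nn_integral_shifted_iso_normal_resample:
  fixes h :: "real ^ 'n \<Rightarrow> ennreal"
  assumes [measurable]: "h \<in> borel_measurable borel" and "0 < \<sigma>" "w \<noteq> 0" "w \<bullet> \<mu> = 0"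
  shows "(\<integral>\<^sup>+y. \<integral>\<^sup>+x. h (resample w x y) \<partial>centered_normal (\<sigma> * norm w) \<partial>distr (iso_normal \<sigma>) borel ((+) \<mu>))
       = (\<integral>\<^sup>+y. h y \<partial>distr (iso_normal \<sigma>) borel ((+) \<mu>))"
proof -
  interpret real_distribution "centered_normal (\<sigma> * norm w)"
    by (rule real_distribution_centered_normal) (use assms in simp)
  have "resample w x (\<mu> + y) = \<mu> + resample w x y" for x y
    using assms by (simp add: resample_def inner_add_right)
  then show ?thesis
    using nn_integral_iso_normal_resample[of "\<lambda>y. h (\<mu> + y)" \<sigma> w] assms(2,3)
    by (simp add: nn_integral_distr)
qed

lemma AE_shifted_iso_normal_inner_neq:
  assumes "v \<noteq> (0 :: real ^ 'n)"
  shows "AE y in distr (iso_normal \<sigma>) borel ((+) \<mu>). v \<bullet> y \<noteq> c"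
proof -
  have "{y. v \<bullet> y = c - v \<bullet> \<mu>} \<in> null_sets lebesgue"
    using negligible_hyperplane[of v "c - v \<bullet> \<mu>"] assms by (simp add: negligible_iff_null_sets)
  then have "AE y in lebesgue. \<not> v \<bullet> y = c - v \<bullet> \<mu>"
    by (rule AE_not_in[THEN AE_mp]) auto
  then have "AE y in lborel. \<not> v \<bullet> y = c - v \<bullet> \<mu>"
    by (simp add: AE_completion_iff)
  then have "AE y in iso_normal \<sigma>. v \<bullet> (\<mu> + y) \<noteq> c"
    by (subst AE_density) (auto elim!: eventually_mono simp: inner_add_right)
  then show ?thesis by (subst AE_distr_iff) auto
qed

section \<open>Descending chains of orthogonal Gaussian coordinates\<close>

abbreviation gaussian :: "real \<Rightarrow> real ^ 'n \<Rightarrow> (real ^ 'n) measure" where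
  "gaussian \<sigma> \<mu> \<equiv> distr (iso_normal \<sigma>) borel ((+) \<mu>)"

text \<open>The recursion mirrors that of \<open>nested_mass\<close>.\<close>
fun descending :: "ereal \<Rightarrow> real list \<Rightarrow> real \<Rightarrow> bool" where
  "descending u [] l \<longleftrightarrow> ereal l < u"
| "descending u (v # vs) l \<longleftrightarrow> ereal v < u \<and> descending (ereal v) vs l"

lemma descending_map_upt:
  assumes "i < n"
  shows "descending u (map f [i..<n]) l \<longleftrightarrow>
     ereal (f i) < u \<and> (\<forall>k. i \<le> k \<longrightarrow> Suc k < n \<longrightarrow> f (Suc k) < f k) \<and> l < f (n - 1)"
  using assms
proof (induction "n - i" arbitrary: i u rule: less_induct)
  case less
  show ?case
  proof (cases "Suc i = n")
    case True
    then have "[i..<n] = [i]" "n - 1 = i" by auto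
    with True show ?thesis by auto
  next
    case False
    with less.prems have i: "Suc i < n" by simp
    have "descending u (map f [i..<n]) l \<longleftrightarrow> ereal (f i) < u \<and> descending (ereal (f i)) (map f [Suc i..<n]) l"
      using less.prems by (simp add: upt_conv_Cons)
    also have "\<dots> \<longleftrightarrow> ereal (f i) < u \<and> f (Suc i) < f i
        \<and> (\<forall>k. Suc i \<le> k \<longrightarrow> Suc k < n \<longrightarrow> f (Suc k) < f k) \<and> l < f (n - 1)"
      using less.hyps[of "Suc i" "ereal (f i)"] i by simp
    also have "\<dots> \<longleftrightarrow> ereal (f i) < u \<and> (\<forall>k. i \<le> k \<longrightarrow> Suc k < n \<longrightarrow> f (Suc k) < f k) \<and> l < f (n - 1)"
    proof -
      have "(\<forall>k. i \<le> k \<longrightarrow> Q k) \<longleftrightarrow> Q i \<and> (\<forall>k. Suc i \<le> k \<longrightarrow> Q k)" for Q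
        by (metis Suc_le_eq le_less)
      from this[of "\<lambda>k. Suc k < n \<longrightarrow> f (Suc k) < f k"] i show ?thesis by blast
    qed
    finally show ?thesis .
  qed
qed

context
  fixes \<sigma> :: real and \<mu> :: "real ^ 'n::finite" and L :: "real ^ 'n \<Rightarrow> real"
  assumes \<sigma>: "0 < \<sigma>" and L[measurable]: "L \<in> borel_measurable borel"
begin

text \<open>
  By induction the tail of the chain is replaced by its nested integral, with \<open>w \<bullet> y\<close> as the upper bound; the
  factor \<open>w \<bullet> y < U y\<close> may be moved into \<open>h\<close> because the tail is orthogonal to \<open>w\<close>.  Resampling along \<open>w\<close>
  then produces one more integral.
\<close>
lemma nn_integral_descending:
  fixes h :: "real ^ 'n \<Rightarrow> ennreal" and U :: "real ^ 'n \<Rightarrow> ereal"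
  assumes "\<And>w. w \<in> set ws \<Longrightarrow> w \<noteq> 0" "\<And>w. w \<in> set ws \<Longrightarrow> w \<bullet> \<mu> = 0"
    and "sorted_wrt (\<lambda>v w. v \<bullet> w = 0) ws"
    and "h \<in> borel_measurable borel" "U \<in> borel_measurable borel"
    and "\<And>w x y. w \<in> set ws \<Longrightarrow> h (resample w x y) = h y"
    and "\<And>w x y. w \<in> set ws \<Longrightarrow> U (resample w x y) = U y"
    and "\<And>w x y. w \<in> set ws \<Longrightarrow> L (resample w x y) = L y"
  shows "(\<integral>\<^sup>+y. h y * of_bool (descending (U y) (map (\<lambda>w. w \<bullet> y) ws) (L y)) \<partial>gaussian \<sigma> \<mu>)
       = (\<integral>\<^sup>+y. h y * nested_mass (map (\<lambda>w. \<sigma> * norm w) ws) (L y) (U y) \<partial>gaussian \<sigma> \<mu>)"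
  using assms
proof (induction ws arbitrary: h U)
  case Nil
  show ?case by (intro nn_integral_cong) simp
next
  case (Cons w ws)
  note [measurable] = Cons.prems(4,5)
  let ?ss = "map (\<lambda>w. \<sigma> * norm w) ws"
  define k where "k y = h y * of_bool (ereal (w \<bullet> y) < U y)" for y
  have k[measurable]: "k \<in> borel_measurable borel" unfolding k_def[abs_def] of_bool_def by measurable
  have orth: "w \<bullet> v = 0" if "v \<in> set ws" for v using Cons.prems(3) that by simp
  have "(\<integral>\<^sup>+y. h y * of_bool (descending (U y) (map (\<lambda>w. w \<bullet> y) (w # ws)) (L y)) \<partial>gaussian \<sigma> \<mu>)
      = (\<integral>\<^sup>+y. k y * of_bool (descending (ereal (w \<bullet> y)) (map (\<lambda>w. w \<bullet> y) ws) (L y)) \<partial>gaussian \<sigma> \<mu>)"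
    by (intro nn_integral_cong) (simp add: k_def of_bool_conj mult.assoc)
  also have "\<dots> = (\<integral>\<^sup>+y. k y * nested_mass ?ss (L y) (ereal (w \<bullet> y)) \<partial>gaussian \<sigma> \<mu>)"
    by (rule Cons.IH) (use Cons.prems in \<open>auto simp: k_def inner_resample_orthogonal orth\<close>)
  also have "\<dots> = (\<integral>\<^sup>+y. \<integral>\<^sup>+x. k (resample w x y) * nested_mass ?ss (L (resample w x y))
      (ereal (w \<bullet> resample w x y)) \<partial>centered_normal (\<sigma> * norm w) \<partial>gaussian \<sigma> \<mu>)"
    by (rule nn_integral_shifted_iso_normal_resample[symmetric]) (use \<sigma> Cons.prems in auto)
  also have "\<dots> = (\<integral>\<^sup>+y. h y * nested_mass (map (\<lambda>w. \<sigma> * norm w) (w # ws)) (L y) (U y) \<partial>gaussian \<sigma> \<mu>)"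
  proof (rule nn_integral_cong)
    fix y
    have "(\<integral>\<^sup>+x. k (resample w x y) * nested_mass ?ss (L (resample w x y))
        (ereal (w \<bullet> resample w x y)) \<partial>centered_normal (\<sigma> * norm w))
      = (\<integral>\<^sup>+x. h y * (if ereal x < U y then nested_mass ?ss (L y) (ereal x) else 0) \<partial>centered_normal (\<sigma> * norm w))"
      using Cons.prems by (intro nn_integral_cong) (simp add: k_def inner_resample_self)
    also have "\<dots> = h y * nested_mass (map (\<lambda>w. \<sigma> * norm w) (w # ws)) (L y) (U y)"
      by (subst nn_integral_cmult) simp_all
    finally show "(\<integral>\<^sup>+x. k (resample w x y) * nested_mass ?ss (L (resample w x y))
        (ereal (w \<bullet> resample w x y)) \<partial>centered_normal (\<sigma> * norm w))
      = h y * nested_mass (map (\<lambda>w. \<sigma> * norm w) (w # ws)) (L y) (U y)" .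
  qed
  finally show ?case .
qed

text \<open>
  All coordinates of the chain except the first are integrated out.  The remaining integral over the
  coordinate along \<open>w\<close>, with everything else fixed, is the one of
  \<open>nested_mass_probability_integral_transform\<close>.
\<close>
lemma nn_integral_descending_uniform:
  fixes h :: "real ^ 'n \<Rightarrow> ennreal" and U :: "real ^ 'n \<Rightarrow> ereal"
  assumes ws: "\<And>v. v \<in> set (w # ws) \<Longrightarrow> v \<noteq> 0" "\<And>v. v \<in> set (w # ws) \<Longrightarrow> v \<bullet> \<mu> = 0"
    "sorted_wrt (\<lambda>v w. v \<bullet> w = 0) (w # ws)"
    and [measurable]: "h \<in> borel_measurable borel" "U \<in> borel_measurable borel" "B \<in> sets borel"
    and inv: "\<And>v x y. v \<in> set (w # ws) \<Longrightarrow> h (resample v x y) = h y"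
    "\<And>v x y. v \<in> set (w # ws) \<Longrightarrow> U (resample v x y) = U y"
    "\<And>v x y. v \<in> set (w # ws) \<Longrightarrow> L (resample v x y) = L y"
  defines "mass \<equiv> nested_mass (map (\<lambda>w. \<sigma> * norm w) (w # ws))"
    and "desc \<equiv> \<lambda>y. descending (U y) (map (\<lambda>w. w \<bullet> y) (w # ws)) (L y)"
  shows "(\<integral>\<^sup>+y. h y * of_bool (desc y)
            * indicator B (1 - enn2real (mass (L y) (ereal (w \<bullet> y))) / enn2real (mass (L y) (U y))) \<partial>gaussian \<sigma> \<mu>)
       = emeasure uniform01 B * (\<integral>\<^sup>+y. h y * of_bool (desc y) \<partial>gaussian \<sigma> \<mu>)"
proof -
  let ?ss = "map (\<lambda>w. \<sigma> * norm w) ws" and ?N = "centered_normal (\<sigma> * norm w)"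
  define A where "A y x = 1 - enn2real (mass (L y) (ereal x)) / enn2real (mass (L y) (U y))" for y x
  define k where "k y = h y * of_bool (ereal (w \<bullet> y) < U y) * indicator B (A y (w \<bullet> y))" for y
  have [measurable]: "k \<in> borel_measurable borel"
    unfolding k_def[abs_def] of_bool_def A_def mass_def by measurable
  have orth: "w \<bullet> v = 0" if "v \<in> set ws" for v using ws(3) that by simp
  have A_inv: "A (resample v x y) = A y" if "v \<in> set (w # ws)" for v x y
    using inv that by (simp add: A_def fun_eq_iff)
  have pos: "0 < s" if "s \<in> set ?ss" for s using \<sigma> ws(1) that by auto
  have "(\<integral>\<^sup>+y. h y * of_bool (desc y) * indicator B (A y (w \<bullet> y)) \<partial>gaussian \<sigma> \<mu>)
      = (\<integral>\<^sup>+y. k y * of_bool (descending (ereal (w \<bullet> y)) (map (\<lambda>w. w \<bullet> y) ws) (L y)) \<partial>gaussian \<sigma> \<mu>)"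
    by (intro nn_integral_cong) (simp add: k_def desc_def of_bool_conj mult_ac)
  also have "\<dots> = (\<integral>\<^sup>+y. k y * nested_mass ?ss (L y) (ereal (w \<bullet> y)) \<partial>gaussian \<sigma> \<mu>)"
  proof (rule nn_integral_descending)
    show "k (resample v x y) = k y" if "v \<in> set ws" for v x y
      using that inv A_inv by (simp add: k_def inner_resample_orthogonal orth)
  qed (use ws inv in \<open>auto simp: inner_resample_orthogonal orth\<close>)
  also have "\<dots> = (\<integral>\<^sup>+y. \<integral>\<^sup>+x. k (resample w x y) * nested_mass ?ss (L (resample w x y))
      (ereal (w \<bullet> resample w x y)) \<partial>?N \<partial>gaussian \<sigma> \<mu>)"
    by (rule nn_integral_shifted_iso_normal_resample[symmetric]) (use \<sigma> ws in auto)
  also have "\<dots> = (\<integral>\<^sup>+y. emeasure uniform01 B * (h y * mass (L y) (U y)) \<partial>gaussian \<sigma> \<mu>)"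
  proof (rule nn_integral_cong)
    fix y
    have "(\<integral>\<^sup>+x. k (resample w x y) * nested_mass ?ss (L (resample w x y))
        (ereal (w \<bullet> resample w x y)) \<partial>?N)
      = (\<integral>\<^sup>+x. h y * (indicator B (A y x) * (if ereal x < U y then nested_mass ?ss (L y) (ereal x) else 0)) \<partial>?N)"
      using ws inv A_inv by (intro nn_integral_cong) (simp add: k_def inner_resample_self mult_ac)
    also have "\<dots> = h y * (\<integral>\<^sup>+x. indicator B (A y x) * (if ereal x < U y then nested_mass ?ss (L y) (ereal x) else 0) \<partial>?N)"
      by (rule nn_integral_cmult) (unfold A_def mass_def, measurable)
    also have "\<dots> = h y * (emeasure uniform01 B * mass (L y) (U y))"
      using nested_mass_probability_integral_transform[of "\<sigma> * norm w" ?ss B "L y" "U y"] \<sigma> ws(1) pos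
      by (simp add: A_def mass_def del: nested_mass.simps)
    finally show "(\<integral>\<^sup>+x. k (resample w x y) * nested_mass ?ss (L (resample w x y))
        (ereal (w \<bullet> resample w x y)) \<partial>?N) = emeasure uniform01 B * (h y * mass (L y) (U y))"
      by (simp add: mult_ac)
  qed
  also have "\<dots> = emeasure uniform01 B * (\<integral>\<^sup>+y. h y * mass (L y) (U y) \<partial>gaussian \<sigma> \<mu>)"
    by (rule nn_integral_cmult) (unfold mass_def, measurable)
  also have "(\<integral>\<^sup>+y. h y * mass (L y) (U y) \<partial>gaussian \<sigma> \<mu>) = (\<integral>\<^sup>+y. h y * of_bool (desc y) \<partial>gaussian \<sigma> \<mu>)"
    unfolding mass_def desc_def
    by (rule nn_integral_descending[symmetric]) (use ws inv in auto)
  finally show ?thesis by (simp add: A_def)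
qed

end

section \<open>Regression on the selected columns as orthogonal projection\<close>

definition signed_column :: "real ^ 'p ^ 'n \<Rightarrow> 'p + 'p \<Rightarrow> real ^ 'n" where
  "signed_column X i = (case i of Inl j \<Rightarrow> column j X | Inr j \<Rightarrow> - column j X)"

lemma signed_gram_eq_inner: "signed_gram X i j = signed_column X i \<bullet> signed_column X j"
  by (cases i; cases j)
     (simp_all add: signed_column_def matrix_matrix_mult_def transpose_def column_def inner_vec_def
       sum_negf)

lemma signed_corr_eq_inner: "signed_corr X y j = signed_column X j \<bullet> y"
  by (cases j)
     (simp_all add: signed_corr_def signed_column_def matrix_vector_mult_def transpose_def column_def
       inner_vec_def sum_negf)

lemma column_variable_of: "column (variable_of i) X \<in> {signed_column X i, - signed_column X i}"
  by (cases i) (simp_all add: variable_of_def signed_column_def)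

lemma sub_gram_carrier: "sub_gram X is \<in> carrier_mat (length is) (length is)"
  by (simp add: sub_gram_def)

lemma mat_inv_carrier: "A \<in> carrier_mat n n \<Longrightarrow> mat_inv A \<in> carrier_mat n n"
  using mat_inverse(2)[of A n] by (auto simp: mat_inv_def split: option.split)

lemma mat_inv_right_inverse:
  assumes A: "A \<in> carrier_mat n n" and "invertible_mat A"
  shows "A * mat_inv A = 1\<^sub>m n"
proof -
  from assms obtain B where B: "A * B = 1\<^sub>m n" "B * A = 1\<^sub>m (dim_row B)"
    by (auto simp: invertible_mat_def inverts_mat_def)
  have "dim_col B = n" using arg_cong[OF B(1), of dim_col] by simp
  moreover have "dim_row B = n" using arg_cong[OF B(2), of dim_col] A by simp
  ultimately have "A \<in> Units (ring_mat TYPE(real) n ())"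
    using A B by (auto simp: Units_def ring_mat_def intro!: bexI[of _ B])
  then obtain C where "mat_inverse A = Some C"
    using mat_inverse(1)[OF A, of "()"] by (cases "mat_inverse A") auto
  then show ?thesis using mat_inverse(2)[OF A] by (simp add: mat_inv_def)
qed

text \<open>
  For an invertible Gram matrix, the vector in the span of the selected columns whose inner products with
  them are the entries of \<open>v\<close> (\<open>inner_dual_comb\<close>).  Regression is the inner product with it.
\<close>
definition dual_comb :: "real ^ 'p ^ 'n \<Rightarrow> ('p + 'p) list \<Rightarrow> real Matrix.vec \<Rightarrow> real ^ 'n" where
  "dual_comb X is v = (\<Sum>a<length is. vec_index (mat_inv (sub_gram X is) *\<^sub>v v) a *\<^sub>R signed_column X (is ! a))"

lemma regress_eq_inner: "regress X is j v = signed_column X j \<bullet> dual_comb X is v"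
proof -
  have "dim_row (mat_inv (sub_gram X is)) = length is"
    using mat_inv_carrier[OF sub_gram_carrier] by blast
  then show ?thesis
    by (simp add: regress_def scalar_prod_def dual_comb_def cross_gram_def signed_gram_eq_inner
        inner_sum_right lessThan_atLeast0 mult.commute)
qed

lemma dual_comb_in_span: "dual_comb X is v \<in> span (signed_column X ` set is)"
  unfolding dual_comb_def by (intro span_sum span_scale span_base) auto

lemma inner_dual_comb:
  assumes inv: "invertible_mat (sub_gram X is)" and v: "dim_vec v = length is" and b: "b < length is"
  shows "signed_column X (is ! b) \<bullet> dual_comb X is v = vec_index v b"
proof -
  let ?G = "sub_gram X is" and ?w = "mat_inv (sub_gram X is) *\<^sub>v v"
  note G = sub_gram_carrier[of X "is"] and I = mat_inv_carrier[OF sub_gram_carrier, of X "is"]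
  have v': "v \<in> carrier_vec (length is)" using v by (rule carrier_vecI)
  have dim: "dim_vec ?w = length is" using I by auto
  have "?G *\<^sub>v ?w = v"
    using assoc_mult_mat_vec[OF G I v'] mat_inv_right_inverse[OF G inv] v' by simp
  moreover have "vec_index (?G *\<^sub>v ?w) b = signed_column X (is ! b) \<bullet> dual_comb X is v"
    using b dim
    by (simp add: mult_mat_vec_def sub_gram_def scalar_prod_def dual_comb_def signed_gram_eq_inner
        inner_sum_right lessThan_atLeast0 mult.commute Matrix.row_def)
  ultimately show ?thesis by simp
qed

lemma inner_eq_imp_eq_in_span:
  fixes d :: "'b::real_inner"
  assumes "d \<in> span S" "d' \<in> span S" and eq: "\<And>x. x \<in> S \<Longrightarrow> x \<bullet> d = x \<bullet> d'"
  shows "d = d'"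
proof -
  have "orthogonal (d - d') x" if "x \<in> span S" for x
    using that by (rule orthogonal_to_span)
      (simp add: real_inner_class.orthogonal_def inner_diff_left eq inner_commute[of d] inner_commute[of d'])
  then have "orthogonal (d - d') (d - d')" using assms by (simp add: span_diff)
  then show ?thesis by (simp add: orthogonal_self)
qed

text \<open>The vector of the span that has inner product one with every selected column.\<close>
definition equiangular :: "real ^ 'p ^ 'n \<Rightarrow> ('p + 'p) list \<Rightarrow> real ^ 'n" where
  "equiangular X is = dual_comb X is (Matrix.vec (length is) (\<lambda>_. 1))"

definition span_proj :: "real ^ 'p ^ 'n \<Rightarrow> ('p + 'p) list \<Rightarrow> real ^ 'n \<Rightarrow> real ^ 'n" where
  "span_proj X is y = dual_comb X is (Matrix.vec (length is) (\<lambda>a. signed_column X (is ! a) \<bullet> y))"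

definition residual :: "real ^ 'p ^ 'n \<Rightarrow> ('p + 'p) list \<Rightarrow> 'p + 'p \<Rightarrow> real ^ 'n" where
  "residual X is j = signed_column X j - span_proj X is (signed_column X j)"

text \<open>The vector that represents the linear form \<open>lars_ratio\<close> (\<open>lars_ratio_eq_inner\<close>); its norm is the scale \<open>\<rho>\<close>.\<close>
definition ratio_vec :: "real ^ 'p ^ 'n \<Rightarrow> ('p + 'p) list \<Rightarrow> 'p + 'p \<Rightarrow> real ^ 'n" where
  "ratio_vec X is j = (1 / (1 - theta X is j)) *\<^sub>R residual X is j"

lemma theta_eq_inner: "theta X is j = signed_column X j \<bullet> equiangular X is"
  by (simp add: theta_def regress_eq_inner equiangular_def)

lemma proj_corr_eq_inner: "proj_corr X is (signed_corr X y) j = signed_column X j \<bullet> span_proj X is y"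
  by (simp add: proj_corr_def regress_eq_inner span_proj_def signed_corr_eq_inner)

lemma equiangular_in_span: "equiangular X is \<in> span (signed_column X ` set is)"
  and span_proj_in_span: "span_proj X is y \<in> span (signed_column X ` set is)"
  by (simp_all add: equiangular_def span_proj_def dual_comb_in_span)

context
  fixes X :: "real ^ 'p::finite ^ 'n::finite" and "is" :: "('p + 'p) list"
  assumes inv: "invertible_mat (sub_gram X is)"
begin

lemma inner_equiangular: "i \<in> set is \<Longrightarrow> signed_column X i \<bullet> equiangular X is = 1"
  using inner_dual_comb[OF inv] by (auto simp: equiangular_def in_set_conv_nth)

lemma inner_span_proj: "i \<in> set is \<Longrightarrow> signed_column X i \<bullet> span_proj X is y = signed_column X i \<bullet> y"
  using inner_dual_comb[OF inv] by (auto simp: span_proj_def in_set_conv_nth)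

lemma inner_diff_span_proj:
  assumes "z \<in> span (signed_column X ` set is)" shows "z \<bullet> (y - span_proj X is y) = 0"
proof -
  have "orthogonal (y - span_proj X is y) z"
    using assms by (rule orthogonal_to_span)
      (auto simp: real_inner_class.orthogonal_def inner_diff_left inner_span_proj inner_commute[of _ "signed_column X _"])
  then show ?thesis by (simp add: real_inner_class.orthogonal_def inner_commute)
qed

lemma inner_residual: "z \<in> span (signed_column X ` set is) \<Longrightarrow> z \<bullet> residual X is j = 0"
  unfolding residual_def by (rule inner_diff_span_proj)

lemma inner_ratio_vec: "z \<in> span (signed_column X ` set is) \<Longrightarrow> z \<bullet> ratio_vec X is j = 0"
  by (simp add: ratio_vec_def inner_residual)

lemma inner_residual_eq: "residual X is j \<bullet> y = signed_column X j \<bullet> y - signed_column X j \<bullet> span_proj X is y"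
proof -
  have "residual X is j \<bullet> y = residual X is j \<bullet> (y - span_proj X is y)"
    by (simp add: inner_diff_right inner_residual inner_commute[of "residual X is j"] span_proj_in_span)
  also have "\<dots> = signed_column X j \<bullet> (y - span_proj X is y)"
    unfolding residual_def inner_diff_left[of "signed_column X j"] by (simp add: inner_diff_span_proj span_proj_in_span)
  finally show ?thesis by (simp add: inner_diff_right)
qed

lemma lars_ratio_eq_inner: "lars_ratio X y is j = ratio_vec X is j \<bullet> y"
  by (simp add: lars_ratio_def ratio_vec_def signed_corr_eq_inner proj_corr_eq_inner inner_residual_eq)

lemma norm_ratio_vec:
  assumes "theta X is j < 1"
  shows "sqrt (signed_gram X j j - regress X is j (cross_gram X j is)) / (1 - theta X is j)
       = norm (ratio_vec X is j)"
proof -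
  have "cross_gram X j is = Matrix.vec (length is) (\<lambda>a. signed_column X (is ! a) \<bullet> signed_column X j)"
    by (simp add: cross_gram_def signed_gram_eq_inner inner_commute)
  then have "signed_gram X j j - regress X is j (cross_gram X j is) = residual X is j \<bullet> signed_column X j"
    by (simp add: signed_gram_eq_inner regress_eq_inner span_proj_def[symmetric] inner_residual_eq)
  also have "\<dots> = residual X is j \<bullet> residual X is j"
    by (simp add: residual_def[of X "is" j] inner_diff_right[of "_ - _"])
       (simp add: residual_def[symmetric] inner_commute[of "residual X is j"] inner_residual span_proj_in_span)
  finally show ?thesis using assms by (simp add: ratio_vec_def norm_eq_sqrt_inner[of "residual X is j"])
qed

end

section \<open>The LARS path along a tuple that passes the Irrepresentable Check\<close>

text \<open>
  The LARS residual at the value \<open>\<kappa>\<close> is \<open>y\<close> minus the vector of the span for which all active correlations equal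
  \<open>\<kappa>\<close>.  At the knot where \<open>i\<close> enters, its correlation equals \<open>\<kappa>\<close> already, so by uniqueness of that vector the
  residual is the same before and after \<open>i\<close> has joined.
\<close>
lemma lars_tie_transfer:
  fixes y :: "real ^ 'n::finite"
  assumes inv: "invertible_mat (sub_gram X is)" and inv': "invertible_mat (sub_gram X (is @ [i]))"
    and i: "theta X is i < 1"
  defines "\<kappa> \<equiv> lars_ratio X y is i"
  shows "signed_column X j \<bullet> (y - span_proj X is y) + \<kappa> * theta X is j
       = signed_column X j \<bullet> (y - span_proj X (is @ [i]) y) + \<kappa> * theta X (is @ [i]) j"
proof -
  let ?S = "signed_column X ` set (is @ [i])"
  have sub: "span (signed_column X ` set is) \<subseteq> span ?S" by (intro span_mono) auto
  have "signed_column X i \<bullet> (y - span_proj X is y) = \<kappa> * (1 - theta X is i)"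
    using i by (simp add: \<kappa>_def lars_ratio_def signed_corr_eq_inner proj_corr_eq_inner inner_diff_right)
  then have at_i: "signed_column X i \<bullet> (span_proj X is y - \<kappa> *\<^sub>R equiangular X is) = signed_column X i \<bullet> y - \<kappa>"
    by (simp add: theta_eq_inner inner_diff_right algebra_simps)
  have "span_proj X is y - \<kappa> *\<^sub>R equiangular X is
      = span_proj X (is @ [i]) y - \<kappa> *\<^sub>R equiangular X (is @ [i])"
  proof (rule inner_eq_imp_eq_in_span)
    show "span_proj X is y - \<kappa> *\<^sub>R equiangular X is \<in> span ?S"
      using span_proj_in_span[of X "is" y] equiangular_in_span[of X "is"] sub by (intro span_diff span_scale) auto
    show "span_proj X (is @ [i]) y - \<kappa> *\<^sub>R equiangular X (is @ [i]) \<in> span ?S"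
      by (intro span_diff span_scale span_proj_in_span equiangular_in_span)
    fix x assume "x \<in> ?S"
    then obtain k where k: "x = signed_column X k" "k \<in> set (is @ [i])" by auto
    have "x \<bullet> (span_proj X is y - \<kappa> *\<^sub>R equiangular X is) = x \<bullet> y - \<kappa>"
      using k at_i inner_span_proj[OF inv, of k] inner_equiangular[OF inv, of k]
      by (cases "k \<in> set is") (auto simp: inner_diff_right)
    then show "x \<bullet> (span_proj X is y - \<kappa> *\<^sub>R equiangular X is)
        = x \<bullet> (span_proj X (is @ [i]) y - \<kappa> *\<^sub>R equiangular X (is @ [i]))"
      using k inner_span_proj[OF inv', of k] inner_equiangular[OF inv', of k] by (simp add: inner_diff_right)
  qed
  from arg_cong[OF this, of "\<lambda>z. signed_column X j \<bullet> (y - z)"] show ?thesis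
    by (simp add: inner_diff_right theta_eq_inner)
qed

lemma lars_ratio_compare:
  assumes "theta X is j < 1"
  shows "lars_ratio X y is j \<le> c \<longleftrightarrow> signed_column X j \<bullet> (y - span_proj X is y) + c * theta X is j \<le> c"
    and "lars_ratio X y is j < c \<longleftrightarrow> signed_column X j \<bullet> (y - span_proj X is y) + c * theta X is j < c"
  using assms
  by (auto simp: lars_ratio_def signed_corr_eq_inner proj_corr_eq_inner inner_diff_right divide_le_eq
      divide_less_eq algebra_simps)

context
  fixes X :: "real ^ 'p::finite ^ 'n::finite" and "is" :: "('p + 'p) list"
  assumes check: "irrepresentable_check X is"
begin

lemma sub_gram_take_invertible:
  assumes "k \<le> length is" shows "invertible_mat (sub_gram X (take k is))"
proof (cases "k = 0")
  case True
  have "sub_gram X [] * sub_gram X [] = 1\<^sub>m 0" by (rule eq_matI) (simp_all add: sub_gram_def)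
  with True show ?thesis
    by (auto simp: invertible_mat_def inverts_mat_def sub_gram_def intro!: exI[of _ "sub_gram X []"])
next
  case False
  with assms check show ?thesis by (auto simp: irrepresentable_check_def)
qed

lemma theta_take_less_1:
  assumes "k \<le> length is" "j \<notin> set (take k is)" shows "theta X (take k is) j < 1"
proof (cases "k = 0")
  case True
  then show ?thesis by (simp add: theta_eq_inner equiangular_def dual_comb_def)
next
  case False
  with assms check show ?thesis by (auto simp: irrepresentable_check_def)
qed

lemma theta_take_less_1_iff:
  assumes "k \<le> length is" shows "theta X (take k is) j < 1 \<longleftrightarrow> j \<notin> set (take k is)"
  using theta_take_less_1[OF assms] inner_equiangular[OF sub_gram_take_invertible[OF assms], of j]
  by (auto simp: theta_eq_inner)

lemma nth_notin_take:
  assumes "k < length is" shows "is ! k \<notin> set (take k is)"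
proof -
  have "distinct is" using check by (auto simp: irrepresentable_check_def distinct_map)
  with assms show ?thesis by (auto simp: in_set_conv_nth nth_eq_iff_index_eq)
qed

lemma theta_nth: "k < length is \<Longrightarrow> theta X (take k is) (is ! k) < 1"
  by (simp add: theta_take_less_1 nth_notin_take)

lemma lars_ratio_step:
  fixes y :: "real ^ 'n"
  assumes k: "k < length is" and j: "j \<notin> set (take (Suc k) is)"
  defines "\<kappa> \<equiv> lars_ratio X y (take k is) (is ! k)"
  shows "lars_ratio X y (take k is) j \<le> \<kappa> \<longleftrightarrow> lars_ratio X y (take (Suc k) is) j \<le> \<kappa>"
    and "lars_ratio X y (take k is) j < \<kappa> \<longleftrightarrow> lars_ratio X y (take (Suc k) is) j < \<kappa>"
proof -
  have snoc: "take (Suc k) is = take k is @ [is ! k]" using k by (simp add: take_Suc_conv_app_nth)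
  have lt: "theta X (take k is) j < 1" "theta X (take (Suc k) is) j < 1"
    using k j theta_take_less_1[of k j] theta_take_less_1[OF _ j] by (simp_all add: snoc)
  have inv: "invertible_mat (sub_gram X (take k is))" "invertible_mat (sub_gram X (take (Suc k) is))"
    using k by (auto intro!: sub_gram_take_invertible)
  note eq = lars_tie_transfer[OF inv(1) inv(2)[unfolded snoc] theta_nth[OF k], where y=y and j=j]
  show "lars_ratio X y (take k is) j \<le> \<kappa> \<longleftrightarrow> lars_ratio X y (take (Suc k) is) j \<le> \<kappa>"
    unfolding lars_ratio_compare(1)[OF lt(1)] lars_ratio_compare(1)[OF lt(2)]
    using eq by (simp add: \<kappa>_def snoc)
  show "lars_ratio X y (take k is) j < \<kappa> \<longleftrightarrow> lars_ratio X y (take (Suc k) is) j < \<kappa>"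
    unfolding lars_ratio_compare(2)[OF lt(1)] lars_ratio_compare(2)[OF lt(2)]
    using eq by (simp add: \<kappa>_def snoc)
qed

lemma ratio_vec_in_span:
  assumes "k < length is"
  shows "ratio_vec X (take k is) (is ! k) \<in> span (signed_column X ` set (take (Suc k) is))"
proof -
  have "set (take k is) \<subseteq> set (take (Suc k) is)" by (rule set_take_subset_set_take) simp
  moreover have "is ! k \<in> set (take (Suc k) is)" using assms by (simp add: take_Suc_conv_app_nth)
  ultimately show ?thesis
    unfolding ratio_vec_def residual_def
    by (intro span_scale span_diff span_base imageI
         subsetD[OF span_mono[OF image_mono] span_proj_in_span])
qed

text \<open>
  If it were zero, the \<open>k\<close>-th column would lie in the span of the previous ones; but the Gram matrix of the first
  \<open>k + 1\<close> columns is invertible, so some vector is orthogonal to the previous columns and not to this one.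
\<close>
lemma ratio_vec_neq_0:
  assumes k: "k < length is" shows "ratio_vec X (take k is) (is ! k) \<noteq> 0"
proof
  let ?is = "take (Suc k) is" and ?v = "Matrix.vec (Suc k) (\<lambda>a. if a = k then 1 else 0 :: real)"
  assume "ratio_vec X (take k is) (is ! k) = 0"
  then have "signed_column X (is ! k) = span_proj X (take k is) (signed_column X (is ! k))"
    using theta_nth[OF k] by (simp add: ratio_vec_def residual_def)
  then have in_span: "signed_column X (is ! k) \<in> span (signed_column X ` set (take k is))"
    by (metis span_proj_in_span)
  have inv: "invertible_mat (sub_gram X ?is)" using k by (simp add: sub_gram_take_invertible)
  have dual: "signed_column X (is ! b) \<bullet> dual_comb X ?is ?v = (if b = k then 1 else 0)" if "b \<le> k" for b
    using inner_dual_comb[OF inv, of ?v b] k that by (simp add: min_def)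
  have "orthogonal (dual_comb X ?is ?v) (signed_column X (is ! k))"
    using in_span
  proof (rule orthogonal_to_span)
    fix x assume "x \<in> signed_column X ` set (take k is)"
    then obtain b where "x = signed_column X (is ! b)" "b < k" using k by (auto simp: in_set_conv_nth)
    then show "orthogonal (dual_comb X ?is ?v) x"
      using dual[of b] by (simp add: real_inner_class.orthogonal_def inner_commute)
  qed
  then show False using dual[of k] by (simp add: real_inner_class.orthogonal_def inner_commute)
qed

lemma ratio_vec_orthogonal_span:
  assumes "k \<le> length is" "a \<le> k" "z \<in> span (signed_column X ` set (take a is))"
  shows "z \<bullet> ratio_vec X (take k is) j = 0"
proof -
  have "set (take a is) \<subseteq> set (take k is)" using assms(2) by (rule set_take_subset_set_take)
  then show ?thesis
    using assms(3) span_mono[OF image_mono] by (intro inner_ratio_vec sub_gram_take_invertible assms(1)) blast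
qed

lemma ratio_vec_orthogonal:
  assumes "k \<le> length is" "l < k"
  shows "ratio_vec X (take l is) (is ! l) \<bullet> ratio_vec X (take k is) j = 0"
  by (rule ratio_vec_orthogonal_span[of k "Suc l"]) (use assms in \<open>auto intro!: ratio_vec_in_span\<close>)

end

lemma length_first_indices[simp]: "length (first_indices idx k) = k"
  by (simp add: first_indices_def)

lemma nth_first_indices: "k < n \<Longrightarrow> first_indices idx n ! k = idx (Suc k)"
  by (simp add: first_indices_def del: upt.simps)

lemma take_first_indices: "k \<le> n \<Longrightarrow> take k (first_indices idx n) = first_indices idx k"
  by (rule nth_equalityI) (simp_all add: nth_first_indices)

definition last_knot :: "real ^ 'p ^ 'n \<Rightarrow> ('p + 'p) list \<Rightarrow> real ^ 'n \<Rightarrow> real" where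
  "last_knot X is y = Max (lars_ratio X y is ` {j. theta X is j < 1})"

lemma lars_path_selected:
  assumes check: "irrepresentable_check X is" and K: "length is = K"
    and path: "lars_path X y (K + 1) lam idx" and first: "first_indices idx K = is"
  shows "k < K \<Longrightarrow> lam (Suc k) = ereal (lars_ratio X y (take k is) (is ! k))"
    and "lam (Suc K) = ereal (last_knot X is y)"
    and "Suc k < K \<Longrightarrow> lars_ratio X y (take (Suc k) is) (is ! Suc k) \<le> lars_ratio X y (take k is) (is ! k)"
    and "Suc k = K \<Longrightarrow> last_knot X is y \<le> lars_ratio X y (take k is) (is ! k)"
    and "theta X is (idx (Suc K)) < 1" "last_knot X is y = lars_ratio X y is (idx (Suc K))"
proof -
  have prefix: "first_indices idx k = take k is" if "k \<le> K" for k
    using take_first_indices[OF that, of idx] first by simp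
  have idx: "idx (Suc k) = is ! k" if "k < K" for k
    using nth_first_indices[OF that, of idx] first by simp
  have step: "lam (Suc k) = ereal (Max (lars_ratio X y (take k is) ` {j. theta X (take k is) j < 1}))"
    "theta X (take k is) (idx (Suc k)) < 1"
    "\<And>j. theta X (take k is) j < 1 \<Longrightarrow> lars_ratio X y (take k is) j \<le> lars_ratio X y (take k is) (idx (Suc k))"
    if "k \<le> K" for k
    using path that by (force simp: lars_path_def Let_def is_arg_max_def prefix not_less)+
  have max: "Max (lars_ratio X y (take k is) ` {j. theta X (take k is) j < 1}) = lars_ratio X y (take k is) (idx (Suc k))"
    if "k \<le> K" for k
    using step(2,3)[OF that] by (intro Max_eqI) auto
  show 1: "lam (Suc k) = ereal (lars_ratio X y (take k is) (is ! k))" if "k < K" for k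
    using step(1)[of k] max[of k] idx[OF that] that by simp
  show "lam (Suc K) = ereal (last_knot X is y)"
    using step(1)[of K] K by (simp add: last_knot_def)
  show "theta X is (idx (Suc K)) < 1" using step(2)[of K] K by simp
  show last: "last_knot X is y = lars_ratio X y is (idx (Suc K))" using max[of K] K by (simp add: last_knot_def)
  have below: "lars_ratio X y (take (Suc k) is) j \<le> lars_ratio X y (take k is) (is ! k)"
    if "k < K" "theta X (take (Suc k) is) j < 1" for k j
  proof -
    have j: "j \<notin> set (take (Suc k) is)" using that theta_take_less_1_iff[OF check, of "Suc k"] K by simp
    then have "j \<notin> set (take k is)" using that K by (auto simp: take_Suc_conv_app_nth)
    then have "theta X (take k is) j < 1" using that K theta_take_less_1[OF check, of k] by simp
    then have "lars_ratio X y (take k is) j \<le> lars_ratio X y (take k is) (is ! k)"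
      using step(3)[of k j] that idx by simp
    then show ?thesis using lars_ratio_step(1)[OF check _ j] that K by simp
  qed
  show "Suc k < K \<Longrightarrow> lars_ratio X y (take (Suc k) is) (is ! Suc k) \<le> lars_ratio X y (take k is) (is ! k)"
    using below[of k "is ! Suc k"] theta_nth[OF check] K by simp
  show "Suc k = K \<Longrightarrow> last_knot X is y \<le> lars_ratio X y (take k is) (is ! k)"
    using below[of k "idx (Suc K)"] step(2)[of K] last K by auto
qed

text \<open>
  Going down from the last step, \<open>lars_ratio_step\<close> carries each strict inequality to the previous step: every \<open>is ! k\<close> is
  the only maximiser of its step.  Going up again, the path has no choice but to select it.
\<close>
lemma lars_path_strict_selects:
  assumes check: "irrepresentable_check X is" and K: "length is = K"
    and path: "lars_path X y (K + 1) lam idx"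
    and strict: "\<And>k. Suc k < K \<Longrightarrow> lars_ratio X y (take (Suc k) is) (is ! Suc k) < lars_ratio X y (take k is) (is ! k)"
    and last: "\<And>k. Suc k = K \<Longrightarrow> last_knot X is y < lars_ratio X y (take k is) (is ! k)"
  shows "first_indices idx K = is"
proof -
  have unique: "lars_ratio X y (take k is) j < lars_ratio X y (take k is) (is ! k)"
    if "k < K" "j \<notin> set (take (Suc k) is)" for k j
    using that
  proof (induction "K - k" arbitrary: k j rule: less_induct)
    case less
    have "lars_ratio X y (take (Suc k) is) j < lars_ratio X y (take k is) (is ! k)"
    proof (cases "Suc k = K")
      case True
      have "lars_ratio X y is j \<le> last_knot X is y"
        unfolding last_knot_def using less.prems True K theta_take_less_1[OF check, of K j]
        by (intro Max_ge) auto
      with True last[OF True] K show ?thesis by simp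
    next
      case False
      with less.prems have k: "Suc k < K" by simp
      have "lars_ratio X y (take (Suc k) is) j \<le> lars_ratio X y (take (Suc k) is) (is ! Suc k)"
      proof (cases "j = is ! Suc k")
        case False
        then have "j \<notin> set (take (Suc (Suc k)) is)"
          using less.prems k K by (simp add: take_Suc_conv_app_nth[of "Suc k"])
        then show ?thesis using less.hyps[of "Suc k" j] k by (simp add: diff_less_mono2)
      qed simp
      with strict[OF k] show ?thesis by simp
    qed
    then show ?case using lars_ratio_step(2)[OF check _ less.prems(2)] less.prems K by simp
  qed
  have "first_indices idx k = take k is" if "k \<le> K" for k
    using that
  proof (induction k)
    case 0 show ?case by (simp add: first_indices_def)
  next
    case (Suc k)
    then have prefix: "first_indices idx k = take k is" by simp
    have arg: "theta X (take k is) (idx (Suc k)) < 1"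
      "\<And>j. theta X (take k is) j < 1 \<Longrightarrow> lars_ratio X y (take k is) j \<le> lars_ratio X y (take k is) (idx (Suc k))"
      using path[unfolded lars_path_def Let_def, THEN conjunct2, rule_format, of "Suc k"] Suc.prems
      by (auto simp: is_arg_max_def prefix not_less) (metis not_le)
    have "idx (Suc k) = is ! k"
    proof (rule ccontr)
      assume neq: "idx (Suc k) \<noteq> is ! k"
      moreover have "idx (Suc k) \<notin> set (take k is)"
        using arg(1) theta_take_less_1_iff[OF check, of k] Suc.prems K by simp
      ultimately have "idx (Suc k) \<notin> set (take (Suc k) is)"
        using Suc.prems K by (simp add: take_Suc_conv_app_nth)
      from unique[OF _ this] Suc.prems arg(2)[OF theta_nth[OF check, of k]] K show False by simp
    qed
    then show ?case using prefix Suc.prems K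
      by (simp add: take_Suc_conv_app_nth first_indices_def)
  qed
  from this[of K] K show ?thesis by simp
qed

section \<open>The test statistic\<close>

lemma I_iter_cong:
  assumes "\<And>i. i \<in> {1..b} \<Longrightarrow> \<tau> i = \<tau>' i"
  shows "I_iter \<tau> a b s t = I_iter \<tau>' a b s t"
proof (induction "b - a" arbitrary: a s rule: less_induct)
  case less
  show ?case
  proof (cases "b \<le> a + 1")
    case True
    then show ?thesis by (subst (1 2) I_iter.simps) simp
  next
    case False
    have Phi: "Phi \<tau> i = Phi \<tau>' i" if "i \<in> {1..b}" for i
      using assms[OF that] by (simp add: Phi_def fun_eq_iff)
    have "P_trans \<tau> (a + 1) j = P_trans \<tau>' (a + 1) j" if "j \<le> b" for j
      using that False Phi[of j] Phi[of "a + 1"] by (cases "j = 0") (simp_all add: P_trans_def[abs_def])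
    moreover have "I_iter \<tau> (a + 1) b f t = I_iter \<tau>' (a + 1) b f t" for f
      using False by (intro less) auto
    ultimately show ?thesis using False by (subst (1 2) I_iter.simps) simp
  qed
qed

text \<open>
  The statistic reads the scales \<open>1, \<dots>, c\<close> only; the value at \<open>0\<close> depends on the arbitrary index \<open>idx 0\<close>.
\<close>
lemma alpha_hat_cong:
  assumes "\<And>i. i \<in> {1..c} \<Longrightarrow> \<tau> i = \<tau>' i" and "a < b" "b < c"
  shows "alpha_hat \<tau> lam a b c = alpha_hat \<tau>' lam a b c"
proof -
  have Phi: "Phi \<tau> i = Phi \<tau>' i" if "i \<in> {1..c}" for i
    using assms(1)[OF that] by (simp add: Phi_def fun_eq_iff)
  have "I_iter \<tau> a b = I_iter \<tau>' a b" "I_iter \<tau> b c = I_iter \<tau>' b c"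
    using assms by (auto simp: fun_eq_iff intro!: I_iter_cong)
  then show ?thesis
    using assms Phi by (simp add: alpha_hat_def F_abc_def F_knot_def)
qed

lemma borel_measurable_F_abc:
  assumes [measurable]: "(\<lambda>\<omega>. lam \<omega> a) \<in> borel_measurable N" "(\<lambda>\<omega>. lam \<omega> c) \<in> borel_measurable N"
    "t \<in> borel_measurable N"
  shows "(\<lambda>\<omega>. F_abc \<tau> (lam \<omega>) a b c (t \<omega>)) \<in> borel_measurable N"
proof -
  have [measurable]: "(\<lambda>\<omega>. F_knot \<tau> (lam \<omega>) a) \<in> borel_measurable N" "(\<lambda>\<omega>. F_knot \<tau> (lam \<omega>) c) \<in> borel_measurable N"
    unfolding F_knot_def by measurable
  show ?thesis
    unfolding F_abc_def interval_lebesgue_integral_def set_lebesgue_integral_def einterval_def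
      indicator_def real_scaleR_def mem_Collect_eq
    by measurable
qed

lemma borel_measurable_lars_ratio[measurable]: "(\<lambda>y. lars_ratio X y is j) \<in> borel_measurable borel"
proof -
  have "dual_comb X is (Matrix.vec (length is) (\<lambda>a. signed_column X (is ! a) \<bullet> y))
      = (\<Sum>a<length is. (\<Sum>b<length is. index_mat (mat_inv (sub_gram X is)) (a, b)
          * (signed_column X (is ! b) \<bullet> y)) *\<^sub>R signed_column X (is ! a))" for y
    using mat_inv_carrier[OF sub_gram_carrier, of X "is"]
    by (auto simp: dual_comb_def mult_mat_vec_def scalar_prod_def Matrix.row_def lessThan_atLeast0
        intro!: sum.cong)
  then have [measurable]: "span_proj X is \<in> borel_measurable borel"
    by (simp add: span_proj_def[abs_def])
  show ?thesis
    unfolding lars_ratio_def signed_corr_eq_inner proj_corr_eq_inner by measurable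
qed

lemma rho_cong:
  assumes "\<And>k. k \<in> {1..l} \<Longrightarrow> idx k = idx' k" "1 \<le> l"
  shows "rho X idx l = rho X idx' l"
proof -
  have "first_indices idx (l - 1) = first_indices idx' (l - 1)"
    using assms by (intro nth_equalityI) (simp_all add: nth_first_indices)
  then show ?thesis using assms by (simp add: rho_def)
qed

text \<open>
  The scale \<open>\<rho>\<^sub>K\<^sub>+\<^sub>1\<close> cancels, because \<open>\<Phi>\<^sub>K\<^sub>+\<^sub>1\<close> is applied to \<open>\<lambda>\<^sub>K\<^sub>+\<^sub>1\<close> and inverted again.  This remains true if the
  scale is zero: then the last knot is zero as well, and zero is the only point at which the
  degenerate \<open>\<Phi>\<^sub>K\<^sub>+\<^sub>1\<close> takes its middle value.
\<close>
lemma alpha_hat_eq_nested_mass: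
  assumes check: "irrepresentable_check X is" and K: "length is = K" and a: "a < K" and \<sigma>: "0 < \<sigma>"
    and path: "lars_path X y (K + 1) lam idx" and first: "first_indices idx K = is"
    and desc: "descending \<infinity> (map (\<lambda>k. ratio_vec X (take k is) (is ! k) \<bullet> y) [0..<K]) (last_knot X is y)"
  defines "mass \<equiv> nested_mass (map (\<lambda>w. \<sigma> * norm w) (map (\<lambda>k. ratio_vec X (take k is) (is ! k)) [a..<K])) (last_knot X is y)"
  shows "alpha_hat (\<lambda>i. \<sigma> * rho X idx i) lam a (a + 1) (K + 1)
       = 1 - enn2real (mass (ereal (ratio_vec X (take a is) (is ! a) \<bullet> y))) / enn2real (mass (lam a))"
proof -
  define W where "W k = ratio_vec X (take k is) (is ! k)" for k
  define \<tau> where "\<tau> i = \<sigma> * rho X idx i" for i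
  define l where "l = last_knot X is y"
  note sel = lars_path_selected[OF check K path first]
  have inv: "invertible_mat (sub_gram X (take k is))" if "k \<le> K" for k
    using that K by (intro sub_gram_take_invertible check) simp
  have lam: "lam (Suc k) = ereal (W k \<bullet> y)" if "k < K" for k
    using sel(1)[OF that] inv[of k] that by (simp add: lars_ratio_eq_inner W_def)
  have lam_K: "lam (Suc K) = ereal l" using sel(2) by (simp add: l_def)
  have rho: "rho X idx (Suc k) = norm (W k)" if "k < K" for k
  proof -
    have "first_indices idx k = take k is" "idx (Suc k) = is ! k"
      using take_first_indices[of k K idx] nth_first_indices[OF that, of idx] first that by simp_all
    then show ?thesis
      using norm_ratio_vec[OF inv[of k] theta_nth[OF check, of k]] that K
      by (simp add: rho_def Let_def W_def)
  qed
  have pos: "0 < \<tau> i" if "i \<in> {1..<K + 1}" for i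
    using that rho[of "i - 1"] ratio_vec_neq_0[OF check, of "i - 1"] \<sigma> K by (auto simp: \<tau>_def W_def)
  have T: "inv_into UNIV (Phi \<tau> (K + 1)) (F_knot \<tau> lam (K + 1)) = ereal l"
  proof -
    let ?v = "ratio_vec X is (idx (Suc K))"
    have "rho X idx (Suc K) = norm ?v"
      using norm_ratio_vec[OF _ sel(5)] inv[of K] K first by (simp add: rho_def Let_def)
    then have tau: "\<tau> (K + 1) = \<sigma> * norm ?v" by (simp add: \<tau>_def)
    show ?thesis
    proof (cases "?v = 0")
      case False
      then show ?thesis using inv_Phi[of \<tau> "K + 1"] tau \<sigma> lam_K by (simp add: F_knot_def)
    next
      case True
      \<comment> \<open>The variable that enters last is collinear with the selected ones, so its ratio vanishes.\<close>
      have "l = 0" using sel(6) True inv[of K] K by (simp add: l_def lars_ratio_eq_inner)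
      moreover have "x = 0" if "Phi \<tau> (K + 1) x = Phi \<tau> (K + 1) 0" for x
      proof -
        have "x / ereal (\<tau> (K + 1)) = 0 / ereal (\<tau> (K + 1))"
          using that strict_mono_eq[OF std_normal_cdf_strict_mono] by (simp only: Phi_def)
        then show ?thesis
          using tau True by (auto simp: ereal_divide_ereal_cases split: ereal.splits if_splits)
      qed
      ultimately show ?thesis
        by (auto simp: F_knot_def lam_K inv_into_def zero_ereal_def[symmetric] intro!: some_equality)
    qed
  qed
  have d: "\<And>k. Suc k < K \<Longrightarrow> W (Suc k) \<bullet> y < W k \<bullet> y" "l < W (K - 1) \<bullet> y"
    using desc descending_map_upt[of 0 K \<infinity> "\<lambda>k. W k \<bullet> y" l] a by (simp_all add: W_def l_def)
  have l_less: "l < W k \<bullet> y" if "k < K" for k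
    using that
  proof (induction "K - k" arbitrary: k rule: less_induct)
    case less
    show ?case
    proof (cases "Suc k = K")
      case True then show ?thesis using d(2) by auto
    next
      case False
      then have "l < W (Suc k) \<bullet> y" using less.prems by (intro less.hyps) auto
      then show ?thesis using d(1)[of k] False less.prems by simp
    qed
  qed
  have mass: "mass = nested_mass (map \<tau> [a + 1..<K + 1]) l"
  proof -
    have "map \<tau> [a + 1..<K + 1] = map (\<lambda>k. \<tau> (Suc k)) [a..<K]"
      by (simp add: map_Suc_upt[symmetric] del: upt.simps)
    also have "\<dots> = map (\<lambda>w. \<sigma> * norm w) (map W [a..<K])"
      by (simp add: \<tau>_def rho)
    finally have "map \<tau> [a + 1..<K + 1] = map (\<lambda>w. \<sigma> * norm w) (map W [a..<K])" .
    moreover have "(\<lambda>k. ratio_vec X (take k is) (is ! k)) = W" by (simp add: W_def fun_eq_iff)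
    ultimately show ?thesis by (simp only: mass_def l_def)
  qed
  have F: "F_abc \<tau> lam a (a + 1) (K + 1) t = enn2real (mass t)" if t: "ereal l \<le> t" "t \<le> lam a" for t
  proof -
    have I1: "I_iter \<tau> a (a + 1) s f = 1" for s f by (subst I_iter.simps) simp
    have "F_abc \<tau> lam a (a + 1) (K + 1) t
        = (LBINT f=Phi \<tau> (a + 1) (ereal l)..Phi \<tau> (a + 1) t. I_iter \<tau> (a + 1) (K + 1) f (F_knot \<tau> lam (K + 1)))"
      using t lam_K unfolding F_abc_def I1 by simp
    also have "\<dots> = enn2real (mass t)"
      unfolding mass by (rule outer_integral_eq_nested_mass) (use a pos T t in auto)
    finally show ?thesis .
  qed
  have "lam (a + 1) \<le> lam a"
  proof (cases a)
    case 0 then show ?thesis using path by (simp add: lars_path_def)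
  next
    case (Suc k) then show ?thesis using lam[of k] lam[of a] d(1)[of k] a by simp
  qed
  moreover have "ereal l \<le> lam (a + 1)" using lam[of a] l_less[of a] a by simp
  moreover from calculation have "ereal l \<le> lam a" by (meson order_trans)
  ultimately show ?thesis
    using F[of "lam (a + 1)"] F[of "lam a"] lam[of a] a
    by (simp add: alpha_hat_def \<tau>_def[abs_def] W_def)
qed

section \<open>The law of the test statistic on one selection event\<close>

text \<open>The mean \<open>\<mu>\<close> plays the part of \<open>X\<beta>\<^sup>0\<close>; the null hypothesis puts it into the span of the selected columns.\<close>
locale lars_experiment = prob_space M
  for M :: "'a measure" +
  fixes X :: "real ^ 'p::finite ^ 'n::finite" and \<mu> :: "real ^ 'n"
    and \<eta> :: "'a \<Rightarrow> real ^ 'n" and \<sigma> :: real and K :: nat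
    and lam :: "'a \<Rightarrow> nat \<Rightarrow> ereal" and idx :: "'a \<Rightarrow> nat \<Rightarrow> 'p + 'p"
    and mhat :: "'a \<Rightarrow> nat"
  assumes \<sigma>_pos: "0 < \<sigma>" and K_pos: "1 \<le> K"
    and noise: "distributed M lborel \<eta> (\<lambda>y. ennreal (iso_normal_density \<sigma> y))"
    and path: "\<And>\<omega>. \<omega> \<in> space M \<Longrightarrow> lars_path X (\<mu> + \<eta> \<omega>) (K + 1) (lam \<omega>) (idx \<omega>)"
    and idx_measurable: "\<And>k. k \<in> {1..K + 1} \<Longrightarrow> (\<lambda>\<omega>. idx \<omega> k) \<in> measurable M (count_space UNIV)"
    and stop: "stopping_rule M K lam idx mhat"
begin

definition Y :: "'a \<Rightarrow> real ^ 'n" where "Y \<omega> = \<mu> + \<eta> \<omega>"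

lemma borel_measurable_Y[measurable]: "Y \<in> borel_measurable M"
  using distributed_measurable[OF noise] unfolding Y_def[abs_def] by simp

lemma distr_Y: "distr M borel Y = gaussian \<sigma> \<mu>"
proof -
  have [measurable]: "\<eta> \<in> borel_measurable M" using distributed_measurable[OF noise] by simp
  have "distr M borel Y = distr (distr M lborel \<eta>) borel ((+) \<mu>)"
    by (subst distr_distr) (auto simp: Y_def[abs_def] comp_def)
  then show ?thesis using noise by (simp add: distributed_def)
qed

lemma pathY: "\<omega> \<in> space M \<Longrightarrow> lars_path X (Y \<omega>) (K + 1) (lam \<omega>) (idx \<omega>)"
  using path by (simp add: Y_def)

lemma measurable_first_indices:
  assumes "n \<le> K + 1"
  shows "(\<lambda>\<omega>. first_indices (idx \<omega>) n) \<in> measurable M (count_space {js. length js = n})"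
proof (subst measurable_count_space_eq2)
  show "finite {js :: ('p + 'p) list. length js = n}"
    using finite_lists_length_eq[of "UNIV :: ('p + 'p) set" n] by simp
  have "(\<lambda>\<omega>. first_indices (idx \<omega>) n) -` {js} \<inter> space M \<in> sets M" if js: "length js = n" for js
  proof -
    have [measurable]: "(\<lambda>\<omega>. idx \<omega> (Suc k)) \<in> measurable M (count_space UNIV)" if "k < n" for k
      using that assms by (intro idx_measurable) auto
    have "(\<lambda>\<omega>. first_indices (idx \<omega>) n) -` {js} \<inter> space M = {\<omega> \<in> space M. \<forall>k\<in>{..<n}. idx \<omega> (Suc k) = js ! k}"
      using js by (auto simp: list_eq_iff_nth_eq nth_first_indices)
    also have "\<dots> \<in> sets M" by measurable
    finally show ?thesis .
  qed
  then show "(\<lambda>\<omega>. first_indices (idx \<omega>) n) \<in> space M \<rightarrow> {js. length js = n} \<and>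
    (\<forall>js\<in>{js. length js = n}. (\<lambda>\<omega>. first_indices (idx \<omega>) n) -` {js} \<inter> space M \<in> sets M)"
    by simp
qed

lemma countable_lists_length: "countable {js :: ('p + 'p) list. length js = n}"
  using finite_lists_length_eq[of "UNIV :: ('p + 'p) set" n] by (simp add: countable_finite)

lemma lam_eq_ratio:
  assumes "\<omega> \<in> space M" "k \<le> K"
  shows "lam \<omega> (Suc k) = ereal (lars_ratio X (Y \<omega>) (first_indices (idx \<omega>) k) (idx \<omega> (Suc k)))"
proof -
  let ?R = "lars_ratio X (Y \<omega>) (first_indices (idx \<omega>) k)" and ?P = "\<lambda>j. theta X (first_indices (idx \<omega>) k) j < 1"
  have "lam \<omega> (Suc k) = ereal (Max (?R ` Collect ?P))" and arg: "is_arg_max ?R ?P (idx \<omega> (Suc k))"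
    using pathY[OF assms(1), unfolded lars_path_def Let_def, THEN conjunct2, rule_format, of "Suc k"] assms(2)
    by auto
  moreover have "Max (?R ` Collect ?P) = ?R (idx \<omega> (Suc k))"
  proof (rule Max_eqI)
    show "r \<le> ?R (idx \<omega> (Suc k))" if "r \<in> ?R ` Collect ?P" for r
      using that arg unfolding is_arg_max_def by (auto dest: leI)
    show "?R (idx \<omega> (Suc k)) \<in> ?R ` Collect ?P" using arg by (auto simp: is_arg_max_def)
  qed simp
  ultimately show ?thesis by simp
qed

lemma borel_measurable_lam:
  assumes "k \<le> K + 1" shows "(\<lambda>\<omega>. lam \<omega> k) \<in> borel_measurable M"
proof (cases k)
  case 0
  have "lam \<omega> 0 = \<infinity>" if "\<omega> \<in> space M" for \<omega> using pathY[OF that] by (simp add: lars_path_def)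
  then show ?thesis using 0 by (simp cong: measurable_cong)
next
  case (Suc l)
  then have l: "Suc l \<le> K + 1" using assms by simp
  have "(\<lambda>\<omega>. ereal (lars_ratio X (Y \<omega>) (butlast (first_indices (idx \<omega>) (Suc l))) (last (first_indices (idx \<omega>) (Suc l)))))
      \<in> borel_measurable M"
    by (rule measurable_compose_countable'[OF _ measurable_first_indices[OF l] countable_lists_length]) measurable
  also have "?this \<longleftrightarrow> (\<lambda>\<omega>. lam \<omega> k) \<in> borel_measurable M"
    using l Suc lam_eq_ratio[of _ l] by (intro measurable_cong) (simp add: first_indices_def)
  finally show ?thesis .
qed

lemma stop_fun:
  assumes "b < K"
  shows "\<exists>g :: (nat \<Rightarrow> ereal) \<times> (nat \<Rightarrow> 'p + 'p) \<Rightarrow> real.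
    g \<in> borel_measurable (PiM {1..b} (\<lambda>_. borel) \<Otimes>\<^sub>M PiM {1..K} (\<lambda>_. count_space UNIV)) \<and>
    (\<forall>\<omega>\<in>space M. mhat \<omega> \<le> b \<longleftrightarrow> g (restrict (lam \<omega>) {1..b}, restrict (idx \<omega>) {1..K}) = 1)"
proof -
  have "b \<le> K - 1" using assms by simp
  with stop obtain g :: "(nat \<Rightarrow> ereal) \<times> (nat \<Rightarrow> 'p + 'p) \<Rightarrow> real" where
    g: "g \<in> borel_measurable (PiM {1..b} (\<lambda>_. borel) \<Otimes>\<^sub>M PiM {1..K} (\<lambda>_. count_space UNIV))"
    "\<forall>\<omega>\<in>space M. (if mhat \<omega> \<le> b then 1 else 0) = g (restrict (lam \<omega>) {1..b}, restrict (idx \<omega>) {1..K})"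
    unfolding stopping_rule_def by blast
  have "mhat \<omega> \<le> b \<longleftrightarrow> g (restrict (lam \<omega>) {1..b}, restrict (idx \<omega>) {1..K}) = 1" if "\<omega> \<in> space M" for \<omega>
    using bspec[OF g(2) that] by (cases "mhat \<omega> \<le> b") simp_all
  with g(1) show ?thesis by blast
qed

lemma mhat_less: "\<omega> \<in> space M \<Longrightarrow> mhat \<omega> < K"
proof -
  have "\<forall>\<omega>\<in>space M. mhat \<omega> \<le> K - 1" using stop unfolding stopping_rule_def by blast
  then show "\<omega> \<in> space M \<Longrightarrow> mhat \<omega> < K" using K_pos by fastforce
qed

lemma measurable_mhat: "mhat \<in> measurable M (count_space {..<K})"
proof (subst measurable_count_space_eq2)
  have le: "{\<omega> \<in> space M. mhat \<omega> \<le> b} \<in> sets M" if b: "b < K" for b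
  proof -
    obtain g :: "(nat \<Rightarrow> ereal) \<times> (nat \<Rightarrow> 'p + 'p) \<Rightarrow> real"
    where [measurable]: "g \<in> borel_measurable (PiM {1..b} (\<lambda>_. borel) \<Otimes>\<^sub>M PiM {1..K} (\<lambda>_. count_space UNIV))"
      and g: "\<forall>\<omega>\<in>space M. mhat \<omega> \<le> b \<longleftrightarrow> g (restrict (lam \<omega>) {1..b}, restrict (idx \<omega>) {1..K}) = 1"
      using stop_fun[OF b] by blast
    have "(\<lambda>\<omega>. restrict (lam \<omega>) {1..b}) \<in> measurable M (PiM {1..b} (\<lambda>_. borel))"
      by (rule measurable_restrict, rule borel_measurable_lam) (use b in simp)
    moreover have "(\<lambda>\<omega>. restrict (idx \<omega>) {1..K}) \<in> measurable M (PiM {1..K} (\<lambda>_. count_space UNIV))"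
      by (rule measurable_restrict, rule idx_measurable) simp
    ultimately have "(\<lambda>\<omega>. g (restrict (lam \<omega>) {1..b}, restrict (idx \<omega>) {1..K})) \<in> borel_measurable M"
      by (intro measurable_compose[OF measurable_Pair \<open>g \<in> _\<close>])
    then have "{\<omega> \<in> space M. g (restrict (lam \<omega>) {1..b}, restrict (idx \<omega>) {1..K}) = 1} \<in> sets M"
      by measurable
    also have "{\<omega> \<in> space M. g (restrict (lam \<omega>) {1..b}, restrict (idx \<omega>) {1..K}) = 1} = {\<omega> \<in> space M. mhat \<omega> \<le> b}"
      by (rule Collect_cong) (use g in blast)
    finally show ?thesis .
  qed
  have "mhat -` {b} \<inter> space M \<in> sets M" if b: "b < K" for b
  proof (cases b)
    case 0
    then have "mhat -` {b} \<inter> space M = {\<omega> \<in> space M. mhat \<omega> \<le> b}" by auto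
    with le[OF b] show ?thesis by simp
  next
    case (Suc c)
    then have "mhat -` {b} \<inter> space M = {\<omega> \<in> space M. mhat \<omega> \<le> b} - {\<omega> \<in> space M. mhat \<omega> \<le> c}" by auto
    with le[OF b] le[of c] b Suc show ?thesis by auto
  qed
  then show "mhat \<in> space M \<rightarrow> {..<K} \<and> (\<forall>b\<in>{..<K}. mhat -` {b} \<inter> space M \<in> sets M)"
    using mhat_less by auto
qed simp

definition \<alpha> :: "'a \<Rightarrow> real" where
  "\<alpha> \<omega> = alpha_hat (\<lambda>i. \<sigma> * rho X (idx \<omega>) i) (lam \<omega>) (mhat \<omega>) (mhat \<omega> + 1) (K + 1)"

text \<open>
  Only finitely many index tuples and model sizes occur.  For each of them the scales are constants and the
  statistic is a measurable function of the knots.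
\<close>
lemma borel_measurable_\<alpha>[measurable]: "\<alpha> \<in> borel_measurable M"
proof -
  define f where "f p \<omega> = alpha_hat (\<lambda>i. \<sigma> * rho X (\<lambda>k. fst p ! (k - 1)) i) (lam \<omega>) (snd p) (snd p + 1) (K + 1)"
    for p :: "('p + 'p) list \<times> nat" and \<omega>
  define I where "I = {js :: ('p + 'p) list. length js = K + 1} \<times> {..<K}"
  have I: "countable I" unfolding I_def using countable_lists_length by (intro countable_SIGMA) auto
  have "(\<lambda>\<omega>. (first_indices (idx \<omega>) (K + 1), mhat \<omega>)) \<in> measurable M (count_space {js. length js = K + 1} \<Otimes>\<^sub>M count_space {..<K})"
    by (intro measurable_Pair measurable_first_indices measurable_mhat) simp
  also have "count_space {js :: ('p + 'p) list. length js = K + 1} \<Otimes>\<^sub>M count_space {..<K} = count_space I"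
    unfolding I_def by (rule pair_measure_countable) (auto intro: countable_lists_length)
  finally have g: "(\<lambda>\<omega>. (first_indices (idx \<omega>) (K + 1), mhat \<omega>)) \<in> measurable M (count_space I)" .
  have "(\<lambda>\<omega>. f (first_indices (idx \<omega>) (K + 1), mhat \<omega>) \<omega>) \<in> borel_measurable M"
  proof (rule measurable_compose_countable'[OF _ g I])
    fix p assume "p \<in> I"
    then have "snd p < K" by (auto simp: I_def)
    then show "f p \<in> borel_measurable M"
      unfolding f_def[abs_def] alpha_hat_def
      by (intro borel_measurable_diff borel_measurable_divide borel_measurable_const
          borel_measurable_F_abc borel_measurable_lam) auto
  qed
  also have "?this \<longleftrightarrow> \<alpha> \<in> borel_measurable M"
  proof (rule measurable_cong)
    fix \<omega> assume "\<omega> \<in> space M"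
    have "rho X (idx \<omega>) i = rho X (\<lambda>k. first_indices (idx \<omega>) (K + 1) ! (k - 1)) i" if "i \<in> {1..K + 1}" for i
      using that by (intro rho_cong) (auto simp: nth_first_indices)
    then show "f (first_indices (idx \<omega>) (K + 1), mhat \<omega>) \<omega> = \<alpha> \<omega>"
      unfolding f_def \<alpha>_def fst_conv snd_conv
      by (intro alpha_hat_cong) (use mhat_less[OF \<open>\<omega> \<in> space M\<close>] in simp_all)
  qed
  finally show ?thesis .
qed

definition cell :: "('p + 'p) list \<Rightarrow> nat \<Rightarrow> 'a set" where
  "cell is a = {\<omega> \<in> space M. first_indices (idx \<omega>) K = is \<and> mhat \<omega> = a}"

lemma sets_cell: 
  assumes "length is = K" "a < K" shows "cell is a \<in> sets M"
proof -
  have "cell is a = ((\<lambda>\<omega>. first_indices (idx \<omega>) K) -` {is} \<inter> space M) \<inter> (mhat -` {a} \<inter> space M)"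
    by (auto simp: cell_def)
  moreover have "(\<lambda>\<omega>. first_indices (idx \<omega>) K) -` {is} \<inter> space M \<in> sets M"
    using assms by (intro measurable_sets[OF measurable_first_indices]) auto
  moreover have "mhat -` {a} \<inter> space M \<in> sets M"
    using assms by (intro measurable_sets[OF measurable_mhat]) auto
  ultimately show ?thesis by simp
qed

context
  fixes "is" :: "('p + 'p) list"
  assumes check: "irrepresentable_check X is" and len: "length is = K"
begin

definition W :: "nat \<Rightarrow> real ^ 'n" where "W k = ratio_vec X (take k is) (is ! k)"

lemma lars_ratio_W: "k < K \<Longrightarrow> lars_ratio X y (take k is) (is ! k) = W k \<bullet> y"
  unfolding W_def using len by (intro lars_ratio_eq_inner sub_gram_take_invertible[OF check]) simp

lemma lars_ratio_last: "lars_ratio X y is j = ratio_vec X is j \<bullet> y"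
  using lars_ratio_eq_inner[OF sub_gram_take_invertible[OF check, of K]] len by simp

lemma W_neq_0: "k < K \<Longrightarrow> W k \<noteq> 0"
  unfolding W_def using len by (intro ratio_vec_neq_0[OF check]) simp

lemma W_orthogonal: "k < K \<Longrightarrow> l < K \<Longrightarrow> k \<noteq> l \<Longrightarrow> W k \<bullet> W l = 0"
  using ratio_vec_orthogonal[OF check, of l k "is ! l"] ratio_vec_orthogonal[OF check, of k l "is ! k"] len
  by (cases k l rule: linorder_cases) (auto simp: W_def inner_commute)

lemma W_orthogonal_last: "k < K \<Longrightarrow> W k \<bullet> ratio_vec X is j = 0"
  using ratio_vec_orthogonal[OF check, of K k j] len by (simp add: W_def)

lemma last_knot_resample:
  assumes "k < K" shows "last_knot X is (resample (W k) x y) = last_knot X is y"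
proof -
  have "lars_ratio X (resample (W k) x y) is j = lars_ratio X y is j" for j
    using W_orthogonal_last[OF assms, of j] by (simp add: lars_ratio_last inner_resample_orthogonal inner_commute)
  then have "lars_ratio X (resample (W k) x y) is = lars_ratio X y is" by (simp add: fun_eq_iff)
  then show ?thesis by (simp add: last_knot_def)
qed

lemma borel_measurable_last_knot: "last_knot X is \<in> borel_measurable borel"
  unfolding last_knot_def[abs_def] by (intro borel_measurable_Max) auto

definition sorted_knots :: "nat \<Rightarrow> ereal \<Rightarrow> real ^ 'n \<Rightarrow> bool" where
  "sorted_knots a u y \<longleftrightarrow> descending u (map (\<lambda>k. W k \<bullet> y) [a..<K]) (last_knot X is y)"

text \<open>
  Selecting the tuple forces the knots to be weakly decreasing.  Two of them agree only on a hyperplane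
  orthogonal to a nonzero vector, since distinct orthogonal vectors \<open>w\<^sub>k \<noteq> 0\<close> cannot coincide; for the last knot
  one hyperplane is needed for each candidate variable.
\<close>
lemma AE_first_indices_iff: "AE \<omega> in M. first_indices (idx \<omega>) K = is \<longleftrightarrow> sorted_knots 0 \<infinity> (Y \<omega>)"
proof -
  have neq: "W k \<noteq> v" if "k < K" "W k \<bullet> v = 0" for k v
    using W_neq_0[OF that(1)] that(2) by auto
  have "AE y in gaussian \<sigma> \<mu>. \<forall>k\<in>{..<K - 1}. W (Suc k) \<bullet> y \<noteq> W k \<bullet> y"
  proof (subst AE_finite_all, simp, intro ballI)
    fix k assume k: "k \<in> {..<K - 1}"
    then have "W k \<noteq> W (Suc k)" by (intro neq W_orthogonal) auto
    then show "AE y in gaussian \<sigma> \<mu>. W (Suc k) \<bullet> y \<noteq> W k \<bullet> y"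
      using AE_shifted_iso_normal_inner_neq[of "W (Suc k) - W k" 0 \<sigma> \<mu>] by (auto simp: inner_diff_left)
  qed
  moreover have "AE y in gaussian \<sigma> \<mu>. \<forall>j\<in>UNIV. W (K - 1) \<bullet> y \<noteq> ratio_vec X is j \<bullet> y"
  proof (subst AE_finite_all, simp, intro ballI)
    fix j
    have "W (K - 1) \<noteq> ratio_vec X is j" using K_pos by (intro neq W_orthogonal_last) auto
    then show "AE y in gaussian \<sigma> \<mu>. W (K - 1) \<bullet> y \<noteq> ratio_vec X is j \<bullet> y"
      using AE_shifted_iso_normal_inner_neq[of "W (K - 1) - ratio_vec X is j" 0 \<sigma> \<mu>] by (auto simp: inner_diff_left)
  qed
  ultimately have "AE y in distr M borel Y. (\<forall>k\<in>{..<K - 1}. W (Suc k) \<bullet> y \<noteq> W k \<bullet> y) \<and>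
      (\<forall>j\<in>UNIV. W (K - 1) \<bullet> y \<noteq> ratio_vec X is j \<bullet> y)"
    unfolding distr_Y by (rule AE_conjI)
  then have "AE \<omega> in M. (\<forall>k\<in>{..<K - 1}. W (Suc k) \<bullet> Y \<omega> \<noteq> W k \<bullet> Y \<omega>) \<and>
      (\<forall>j\<in>UNIV. W (K - 1) \<bullet> Y \<omega> \<noteq> ratio_vec X is j \<bullet> Y \<omega>)"
    by (subst (asm) AE_distr_iff) measurable
  then show ?thesis
  proof (rule AE_mp, intro AE_I2 impI)
    fix \<omega> assume \<omega>: "\<omega> \<in> space M" and "(\<forall>k\<in>{..<K - 1}. W (Suc k) \<bullet> Y \<omega> \<noteq> W k \<bullet> Y \<omega>) \<and>
      (\<forall>j\<in>UNIV. W (K - 1) \<bullet> Y \<omega> \<noteq> ratio_vec X is j \<bullet> Y \<omega>)"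
    then have ne: "\<And>k. Suc k < K \<Longrightarrow> W (Suc k) \<bullet> Y \<omega> \<noteq> W k \<bullet> Y \<omega>"
      "\<And>j. W (K - 1) \<bullet> Y \<omega> \<noteq> ratio_vec X is j \<bullet> Y \<omega>" by auto
    have sorted: "sorted_knots 0 \<infinity> (Y \<omega>) \<longleftrightarrow> (\<forall>k. Suc k < K \<longrightarrow> W (Suc k) \<bullet> Y \<omega> < W k \<bullet> Y \<omega>)
        \<and> last_knot X is (Y \<omega>) < W (K - 1) \<bullet> Y \<omega>"
      unfolding sorted_knots_def using K_pos by (subst descending_map_upt) auto
    show "first_indices (idx \<omega>) K = is \<longleftrightarrow> sorted_knots 0 \<infinity> (Y \<omega>)"
    proof
      assume first: "first_indices (idx \<omega>) K = is"
      note sel = lars_path_selected[OF check len pathY[OF \<omega>] first]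
      have "last_knot X is (Y \<omega>) \<le> W (K - 1) \<bullet> Y \<omega>"
        using sel(4)[of "K - 1"] K_pos lars_ratio_W[of "K - 1"] by simp
      moreover have "last_knot X is (Y \<omega>) \<noteq> W (K - 1) \<bullet> Y \<omega>"
        using sel(6) ne(2)[of "idx \<omega> (Suc K)"] by (simp add: lars_ratio_last)
      moreover have "W (Suc k) \<bullet> Y \<omega> < W k \<bullet> Y \<omega>" if "Suc k < K" for k
        using sel(3)[OF that] ne(1)[OF that] that lars_ratio_W[of k] lars_ratio_W[of "Suc k"] by simp
      ultimately show "sorted_knots 0 \<infinity> (Y \<omega>)" unfolding sorted by simp
    next
      assume "sorted_knots 0 \<infinity> (Y \<omega>)"
      then have s: "\<And>k. Suc k < K \<Longrightarrow> W (Suc k) \<bullet> Y \<omega> < W k \<bullet> Y \<omega>"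
        "last_knot X is (Y \<omega>) < W (K - 1) \<bullet> Y \<omega>" unfolding sorted by auto
      show "first_indices (idx \<omega>) K = is"
      proof (rule lars_path_strict_selects[OF check len pathY[OF \<omega>]])
        show "Suc k < K \<Longrightarrow> lars_ratio X (Y \<omega>) (take (Suc k) is) (is ! Suc k)
            < lars_ratio X (Y \<omega>) (take k is) (is ! k)" for k
          using s(1)[of k] lars_ratio_W[of k] lars_ratio_W[of "Suc k"] by simp
        show "Suc k = K \<Longrightarrow> last_knot X is (Y \<omega>) < lars_ratio X (Y \<omega>) (take k is) (is ! k)" for k
          using s(2) lars_ratio_W[of k] by auto
      qed
    qed
  qed
qed

text \<open>
  Once the tuple is fixed, the stopping rule sees \<open>\<lambda>\<^sub>1, \<dots>, \<lambda>\<^sub>b\<close> only.  Therefore its decision is invariant under resampling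
  along the later directions.
\<close>
lemma stop_pred:
  assumes b: "b < K"
  shows "\<exists>H. Measurable.pred borel H
    \<and> (\<forall>y y'. (\<forall>k<b. W k \<bullet> y = W k \<bullet> y') \<longrightarrow> H y = H y')
    \<and> (\<forall>\<omega>\<in>space M. first_indices (idx \<omega>) K = is \<longrightarrow> (mhat \<omega> \<le> b \<longleftrightarrow> H (Y \<omega>)))"
proof -
  obtain g :: "(nat \<Rightarrow> ereal) \<times> (nat \<Rightarrow> 'p + 'p) \<Rightarrow> real"
    where [measurable]: "g \<in> borel_measurable (PiM {1..b} (\<lambda>_. borel) \<Otimes>\<^sub>M PiM {1..K} (\<lambda>_. count_space UNIV))"
    and g: "\<forall>\<omega>\<in>space M. mhat \<omega> \<le> b \<longleftrightarrow> g (restrict (lam \<omega>) {1..b}, restrict (idx \<omega>) {1..K}) = 1"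
    using stop_fun[OF b] by blast
  define P where "P y = (restrict (\<lambda>k. ereal (W (k - 1) \<bullet> y)) {1..b}, restrict (\<lambda>k. is ! (k - 1)) {1..K})" for y
  have [measurable]: "P \<in> measurable borel (PiM {1..b} (\<lambda>_. borel) \<Otimes>\<^sub>M PiM {1..K} (\<lambda>_. count_space UNIV))"
    unfolding P_def[abs_def] by (intro measurable_Pair measurable_restrict measurable_const) (auto simp: space_PiM)
  show ?thesis
  proof (intro exI[of _ "\<lambda>y. g (P y) = 1"] conjI allI ballI impI)
    show "Measurable.pred borel (\<lambda>y. g (P y) = 1)" by measurable
    show "(g (P y) = 1) = (g (P y') = 1)" if eq: "\<forall>k<b. W k \<bullet> y = W k \<bullet> y'" for y y'
    proof -
      have "W (k - 1) \<bullet> y = W (k - 1) \<bullet> y'" if "k \<in> {1..b}" for k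
        using eq that by auto
      then have "P y = P y'" by (auto simp: P_def intro!: restrict_ext)
      then show ?thesis by simp
    qed
  next
    fix \<omega> assume \<omega>: "\<omega> \<in> space M" and first: "first_indices (idx \<omega>) K = is"
    have "lam \<omega> k = ereal (W (k - 1) \<bullet> Y \<omega>)" if "k \<in> {1..b}" for k
      using lars_path_selected(1)[OF check len pathY[OF \<omega>] first, of "k - 1"] lars_ratio_W[of "k - 1"] that b by auto
    moreover have "idx \<omega> k = is ! (k - 1)" if "k \<in> {1..K}" for k
      using nth_first_indices[of "k - 1" K "idx \<omega>"] that first by auto
    ultimately have "(restrict (lam \<omega>) {1..b}, restrict (idx \<omega>) {1..K}) = P (Y \<omega>)"
      by (auto simp: P_def intro!: restrict_ext)
    with bspec[OF g \<omega>] show "mhat \<omega> \<le> b \<longleftrightarrow> g (P (Y \<omega>)) = 1" by simp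
  qed
qed

lemma stop_pred_eq:
  assumes a: "a < K"
  shows "\<exists>G. Measurable.pred borel G
    \<and> (\<forall>y y'. (\<forall>k<a. W k \<bullet> y = W k \<bullet> y') \<longrightarrow> G y = G y')
    \<and> (\<forall>\<omega>\<in>space M. first_indices (idx \<omega>) K = is \<longrightarrow> (mhat \<omega> = a \<longleftrightarrow> G (Y \<omega>)))"
proof -
  obtain H where H: "Measurable.pred borel H"
    "\<forall>y y'. (\<forall>k<a. W k \<bullet> y = W k \<bullet> y') \<longrightarrow> H y = H y'"
    "\<forall>\<omega>\<in>space M. first_indices (idx \<omega>) K = is \<longrightarrow> (mhat \<omega> \<le> a \<longleftrightarrow> H (Y \<omega>))"
    using stop_pred[OF a] by blast
  show ?thesis
  proof (cases a)
    case 0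
    then show ?thesis using H by (intro exI[of _ H]) simp
  next
    case (Suc b)
    then have "b < K" using a by simp
    then obtain H' where H': "Measurable.pred borel H'"
      "\<forall>y y'. (\<forall>k<b. W k \<bullet> y = W k \<bullet> y') \<longrightarrow> H' y = H' y'"
      "\<forall>\<omega>\<in>space M. first_indices (idx \<omega>) K = is \<longrightarrow> (mhat \<omega> \<le> b \<longleftrightarrow> H' (Y \<omega>))"
      using stop_pred[of b] by blast
    show ?thesis
    proof (intro exI[of _ "\<lambda>y. H y \<and> \<not> H' y"] conjI allI ballI impI)
      show "Measurable.pred borel (\<lambda>y. H y \<and> \<not> H' y)" using H(1) H'(1) by measurable
      show "(H y \<and> \<not> H' y) = (H y' \<and> \<not> H' y')" if "\<forall>k<a. W k \<bullet> y = W k \<bullet> y'" for y y'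
        using H(2)[rule_format, of y y'] H'(2)[rule_format, of y y'] that Suc by simp
      show "mhat \<omega> = a \<longleftrightarrow> H (Y \<omega>) \<and> \<not> H' (Y \<omega>)"
        if "\<omega> \<in> space M" "first_indices (idx \<omega>) K = is" for \<omega>
        using H(3)[rule_format, OF that] H'(3)[rule_format, OF that] Suc by auto
    qed
  qed
qed

text \<open>
  The null hypothesis makes \<open>w\<^sub>a\<^sub>+\<^sub>1, \<dots>, w\<^sub>K\<close> orthogonal to the mean, so \<open>nn_integral_descending_uniform\<close> applies to the
  part of the chain below \<open>\<lambda>\<^sub>a\<close>; the part above it and the event \<open>mhat = a\<close> form the invariant factor \<open>h\<close>.
\<close>
lemma emeasure_cell_\<alpha>:
  assumes a: "a < K" and null: "\<mu> \<in> span (signed_column X ` set (take a is))" and B[measurable]: "B \<in> sets borel"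
  shows "emeasure M (cell is a \<inter> \<alpha> -` B) = emeasure uniform01 B * emeasure M (cell is a)"
proof -
  let ?Q = "gaussian \<sigma> \<mu>"
  note [measurable] = borel_measurable_last_knot
  obtain G where G[measurable]: "Measurable.pred borel G"
    and G_cong: "\<forall>y y'. (\<forall>k<a. W k \<bullet> y = W k \<bullet> y') \<longrightarrow> G y = G y'"
    and G_mhat: "\<forall>\<omega>\<in>space M. first_indices (idx \<omega>) K = is \<longrightarrow> (mhat \<omega> = a \<longleftrightarrow> G (Y \<omega>))"
    using stop_pred_eq[OF a] by blast
  define U where "U y = (if a = 0 then \<infinity> else ereal (W (a - 1) \<bullet> y))" for y
  define ws where "ws = map W [Suc a..<K]"
  have ws: "map W [a..<K] = W a # ws" using a by (simp add: ws_def upt_conv_Cons)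
  define mass where "mass = nested_mass (map (\<lambda>w. \<sigma> * norm w) (W a # ws))"
  define A where "A y = 1 - enn2real (mass (last_knot X is y) (ereal (W a \<bullet> y)))
    / enn2real (mass (last_knot X is y) (U y))" for y
  define Pre where "Pre y \<longleftrightarrow> (\<forall>k\<in>{..<a - 1}. W (Suc k) \<bullet> y < W k \<bullet> y)" for y
  \<comment> \<open>The part of the event that resampling along the directions of \<open>W a # ws\<close> does not affect.\<close>
  define h :: "real ^ 'n \<Rightarrow> ennreal" where "h y = of_bool (G y \<and> Pre y)" for y
  have [measurable]: "U \<in> borel_measurable borel" unfolding U_def[abs_def] by measurable
  have [measurable]: "A \<in> borel_measurable borel" unfolding A_def[abs_def] mass_def by measurable
  have [measurable]: "Measurable.pred borel Pre" unfolding Pre_def[abs_def] by measurable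
  have [measurable]: "Measurable.pred borel (sorted_knots 0 \<infinity>)"
  proof -
    have "sorted_knots 0 \<infinity> = (\<lambda>y. (\<forall>k\<in>{..<K - 1}. W (Suc k) \<bullet> y < W k \<bullet> y) \<and> last_knot X is y < W (K - 1) \<bullet> y)"
      unfolding sorted_knots_def fun_eq_iff using K_pos by (subst descending_map_upt) auto
    then show ?thesis by simp
  qed
  have [measurable]: "h \<in> borel_measurable borel" unfolding h_def[abs_def] of_bool_def by measurable
  have split: "sorted_knots 0 \<infinity> y \<longleftrightarrow> Pre y \<and> descending (U y) (map (\<lambda>w. w \<bullet> y) (W a # ws)) (last_knot X is y)" for y
  proof -
    have "sorted_knots 0 \<infinity> y \<longleftrightarrow> (\<forall>k. Suc k < K \<longrightarrow> W (Suc k) \<bullet> y < W k \<bullet> y) \<and> last_knot X is y < W (K - 1) \<bullet> y"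
      unfolding sorted_knots_def using K_pos by (subst descending_map_upt) auto
    moreover have "descending (U y) (map (\<lambda>w. w \<bullet> y) (W a # ws)) (last_knot X is y) \<longleftrightarrow>
        ereal (W a \<bullet> y) < U y \<and> (\<forall>k. a \<le> k \<longrightarrow> Suc k < K \<longrightarrow> W (Suc k) \<bullet> y < W k \<bullet> y)
        \<and> last_knot X is y < W (K - 1) \<bullet> y"
      unfolding ws[symmetric] map_map comp_def using a by (rule descending_map_upt)
    moreover have "(\<forall>k. Suc k < K \<longrightarrow> W (Suc k) \<bullet> y < W k \<bullet> y) \<longleftrightarrow>
        Pre y \<and> ereal (W a \<bullet> y) < U y \<and> (\<forall>k. a \<le> k \<longrightarrow> Suc k < K \<longrightarrow> W (Suc k) \<bullet> y < W k \<bullet> y)"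
      (is "?l = ?r")
    proof
      assume ?l
      then show ?r using a by (cases a) (auto simp: Pre_def U_def)
    next
      assume r: ?r
      show ?l
      proof (intro allI impI)
        fix k assume "Suc k < K"
        consider "a \<le> k" | "Suc k = a" | "k < a - 1" by linarith
        then show "W (Suc k) \<bullet> y < W k \<bullet> y"
          using r \<open>Suc k < K\<close> by cases (auto simp: Pre_def U_def)
      qed
    qed
    ultimately show ?thesis by blast
  qed
  have null_W: "w \<bullet> \<mu> = 0" if "w \<in> set (W a # ws)" for w
  proof -
    from that obtain k where "w = W k" "a \<le> k" "k < K" unfolding ws[symmetric] by auto
    then show ?thesis
      using ratio_vec_orthogonal_span[OF check _ _ null, of k] len by (simp add: W_def inner_commute)
  qed
  have in_ws: "\<exists>k. w = W k \<and> a \<le> k \<and> k < K" if "w \<in> set (W a # ws)" for w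
    using that unfolding ws[symmetric] by auto
  have W_resample: "W l \<bullet> resample w x y = W l \<bullet> y" if "w \<in> set (W a # ws)" "l < a" for w l x y
    using in_ws[OF that(1)] that(2) a W_orthogonal by (auto intro!: inner_resample_orthogonal)
  have main: "(\<integral>\<^sup>+y. h y * of_bool (descending (U y) (map (\<lambda>w. w \<bullet> y) (W a # ws)) (last_knot X is y))
      * indicator B (A y) \<partial>?Q)
    = emeasure uniform01 B * (\<integral>\<^sup>+y. h y * of_bool (descending (U y) (map (\<lambda>w. w \<bullet> y) (W a # ws)) (last_knot X is y)) \<partial>?Q)"
    unfolding A_def mass_def
  proof (rule nn_integral_descending_uniform[OF \<sigma>_pos borel_measurable_last_knot])
    show "v \<noteq> 0" if "v \<in> set (W a # ws)" for v using in_ws[OF that] W_neq_0 by auto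
    show "v \<bullet> \<mu> = 0" if "v \<in> set (W a # ws)" for v using null_W[OF that] .
    show "sorted_wrt (\<lambda>v w. v \<bullet> w = 0) (W a # ws)"
      unfolding ws[symmetric] sorted_wrt_map using W_orthogonal
      by (auto intro!: sorted_wrt_mono_rel[OF _ sorted_wrt_upt])
    show "h (resample v x y) = h y" if "v \<in> set (W a # ws)" for v x y
    proof -
      have "G (resample v x y) = G y" using W_resample[OF that] by (intro G_cong[rule_format]) simp
      moreover have "Pre (resample v x y) = Pre y"
        unfolding Pre_def by (intro ball_cong refl) (simp add: W_resample[OF that])
      ultimately show ?thesis by (simp add: h_def)
    qed
    show "U (resample v x y) = U y" if "v \<in> set (W a # ws)" for v x y
      by (simp add: U_def W_resample[OF that])
    show "last_knot X is (resample v x y) = last_knot X is y" if "v \<in> set (W a # ws)" for v x y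
      using in_ws[OF that] last_knot_resample by auto
  qed measurable
  have \<alpha>_eq: "\<alpha> \<omega> = A (Y \<omega>)"
    if \<omega>: "\<omega> \<in> space M" and first: "first_indices (idx \<omega>) K = is" and m: "mhat \<omega> = a"
      and s: "sorted_knots 0 \<infinity> (Y \<omega>)" for \<omega>
  proof -
    have "lam \<omega> a = U (Y \<omega>)"
    proof (cases a)
      case 0 then show ?thesis using pathY[OF \<omega>] by (simp add: lars_path_def U_def)
    next
      case (Suc b)
      then show ?thesis
        using lars_path_selected(1)[OF check len pathY[OF \<omega>] first, of b] lars_ratio_W[of b] a
        by (simp add: U_def)
    qed
    moreover have "(\<lambda>k. ratio_vec X (take k is) (is ! k)) = W" by (simp add: W_def fun_eq_iff)
    ultimately show ?thesis
      using alpha_hat_eq_nested_mass[OF check len a \<sigma>_pos pathY[OF \<omega>] first] s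
      by (simp add: sorted_knots_def \<alpha>_def m A_def mass_def W_def[symmetric] ws[symmetric])
  qed
  have reduce: "emeasure M (cell is a \<inter> \<alpha> -` C)
      = (\<integral>\<^sup>+y. h y * of_bool (descending (U y) (map (\<lambda>w. w \<bullet> y) (W a # ws)) (last_knot X is y)) * indicator C (A y) \<partial>?Q)"
    if C[measurable]: "C \<in> sets borel" for C
  proof -
    let ?S = "{y. G y \<and> sorted_knots 0 \<infinity> y \<and> A y \<in> C}"
    have S: "?S \<in> sets borel" by measurable
    have "cell is a \<inter> \<alpha> -` C = cell is a \<inter> (\<alpha> -` C \<inter> space M)" by (auto simp: cell_def)
    then have sets: "cell is a \<inter> \<alpha> -` C \<in> sets M"
      using sets_cell[OF len a] measurable_sets[OF borel_measurable_\<alpha> C] by simp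
    have "emeasure M (cell is a \<inter> \<alpha> -` C) = emeasure M (Y -` ?S \<inter> space M)"
    proof (rule emeasure_eq_AE[OF _ sets measurable_sets[OF borel_measurable_Y S]])
      show "AE \<omega> in M. \<omega> \<in> cell is a \<inter> \<alpha> -` C \<longleftrightarrow> \<omega> \<in> Y -` ?S \<inter> space M"
        using AE_first_indices_iff AE_space
      proof eventually_elim
        case (elim \<omega>)
        have "\<omega> \<in> cell is a \<inter> \<alpha> -` C \<longleftrightarrow> first_indices (idx \<omega>) K = is \<and> mhat \<omega> = a \<and> \<alpha> \<omega> \<in> C"
          using elim(2) by (simp add: cell_def)
        also have "\<dots> \<longleftrightarrow> sorted_knots 0 \<infinity> (Y \<omega>) \<and> G (Y \<omega>) \<and> A (Y \<omega>) \<in> C"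
          using elim G_mhat \<alpha>_eq[of \<omega>] by metis
        finally show ?case using elim(2) by auto
      qed
    qed
    also have "\<dots> = emeasure ?Q ?S"
      unfolding distr_Y[symmetric] by (rule emeasure_distr[symmetric]) (use S in auto)
    also have "\<dots> = (\<integral>\<^sup>+y. indicator ?S y \<partial>?Q)" using S by simp
    also have "\<dots> = (\<integral>\<^sup>+y. h y * of_bool (descending (U y) (map (\<lambda>w. w \<bullet> y) (W a # ws)) (last_knot X is y)) * indicator C (A y) \<partial>?Q)"
      by (intro nn_integral_cong) (simp add: indicator_def h_def split of_bool_conj[symmetric])
    finally show ?thesis .
  qed
  show ?thesis using reduce[OF B] reduce[of UNIV] main by simp
qed

end

end

lemma selected_span_subset:
  assumes "a \<le> length is"
  shows "selected_span X (\<lambda>k. is ! (k - 1)) a \<subseteq> span (signed_column X ` set (take a is))"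
  unfolding selected_span_def
proof (rule span_minimal)
  show "(\<lambda>k. column (variable_of (is ! (k - 1))) X) ` {1..a} \<subseteq> span (signed_column X ` set (take a is))"
  proof (intro image_subsetI)
    fix k assume "k \<in> {1..a}"
    then have "is ! (k - 1) \<in> set (take a is)" using assms by (auto simp: in_set_conv_nth intro!: exI[of _ "k - 1"])
    then have "signed_column X (is ! (k - 1)) \<in> span (signed_column X ` set (take a is))"
      by (intro span_base imageI)
    with column_variable_of[of "is ! (k - 1)" X]
    show "column (variable_of (is ! (k - 1))) X \<in> span (signed_column X ` set (take a is))"
      using span_neg by fastforce
  qed
qed (rule subspace_span)

section \<open>The conditional law\<close>

theorem corollary1:
  fixes M :: "'a measure"
    and X :: "real ^ 'p::finite ^ 'n::finite" and \<beta>0 :: "real ^ 'p"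
    and \<eta> :: "'a \<Rightarrow> real ^ 'n" and \<sigma> :: real and K :: nat
    and lam :: "'a \<Rightarrow> nat \<Rightarrow> ereal" and idx :: "'a \<Rightarrow> nat \<Rightarrow> 'p + 'p"
    and mhat :: "'a \<Rightarrow> nat"
  defines "E \<equiv> {\<omega> \<in> space M. X *v \<beta>0 \<in> selected_span X (idx \<omega>) (mhat \<omega>) \<and>
                  irrepresentable_check X (first_indices (idx \<omega>) K)}"
  assumes "prob_space M"
    and "rank X > 0" and "\<sigma> > 0"
    and "1 \<le> K" and "K < min CARD('n) (rank X)"
    and noise: "distributed M lborel \<eta> (\<lambda>y. ennreal (iso_normal_density \<sigma> y))"
    and path: "\<And>\<omega>. \<omega> \<in> space M \<Longrightarrow> lars_path X (X *v \<beta>0 + \<eta> \<omega>) (K + 1) (lam \<omega>) (idx \<omega>)"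
    and idx_measurable:
      "\<And>k. k \<in> {1..K + 1} \<Longrightarrow> (\<lambda>\<omega>. idx \<omega> k) \<in> measurable M (count_space UNIV)"
    and stop: "stopping_rule M K lam idx mhat"
    and positive: "measure M E > 0"
  shows "distributed (uniform_measure M E) lborel
           (\<lambda>\<omega>. alpha_hat (\<lambda>i. \<sigma> * rho X (idx \<omega>) i) (lam \<omega>) (mhat \<omega>) (mhat \<omega> + 1) (K + 1))
           (indicator {0<..<1})"
proof -
  interpret lars_experiment M X "X *v \<beta>0" \<eta> \<sigma> K lam idx mhat
    by (intro lars_experiment.intro lars_experiment_axioms.intro)
       (rule assms(2,4,5) noise path idx_measurable stop; assumption)+
  define V where "V = {(is, a). length is = K \<and> a < K \<and> irrepresentable_check X is
    \<and> X *v \<beta>0 \<in> selected_span X (\<lambda>k. is ! (k - 1)) a}"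
  have "V \<subseteq> {is. length is = K} \<times> {..<K}" by (auto simp: V_def)
  moreover have "finite {is :: ('p + 'p) list. length is = K}"
    using finite_lists_length_eq[of "UNIV :: ('p + 'p) set" K] by simp
  ultimately have fin: "finite V" by (meson finite_SigmaI finite_lessThan finite_subset)
  have E_cells: "E = (\<Union>(is, a)\<in>V. cell is a)"
  proof -
    have "selected_span X (idx \<omega>) (mhat \<omega>) = selected_span X (\<lambda>k. first_indices (idx \<omega>) K ! (k - 1)) (mhat \<omega>)"
      if "\<omega> \<in> space M" for \<omega>
      using mhat_less[OF that] unfolding selected_span_def
      by (intro arg_cong[where f=span] image_cong refl) (auto simp: nth_first_indices)
    then show ?thesis
      using mhat_less unfolding E_def V_def cell_def by auto
  qed
  have cell_eq: "emeasure M (cell is a \<inter> \<alpha> -` B) = emeasure uniform01 B * emeasure M (cell is a)"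
    if "(is, a) \<in> V" "B \<in> sets borel" for "is" a B
    using that selected_span_subset[of a "is" X] by (intro emeasure_cell_\<alpha>) (auto simp: V_def)
  have cell_sets: "cell is a \<in> sets M" if "(is, a) \<in> V" for "is" a
    using that by (intro sets_cell) (auto simp: V_def)
  have E_sets: "E \<in> sets M"
    unfolding E_cells using fin cell_sets by (intro sets.finite_UN) auto
  have disj: "disjoint_family_on (\<lambda>p. (case p of (is, a) \<Rightarrow> cell is a) \<inter> C) V" for C
    by (auto simp: disjoint_family_on_def cell_def)
  have E_sum: "emeasure M (E \<inter> C) = (\<Sum>(is, a)\<in>V. emeasure M (cell is a \<inter> C))"
    if C: "\<And>is a. (is, a) \<in> V \<Longrightarrow> cell is a \<inter> C \<in> sets M" for C
  proof -
    have "emeasure M (E \<inter> C) = emeasure M (\<Union>p\<in>V. (case p of (is, a) \<Rightarrow> cell is a) \<inter> C)"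
      by (simp add: E_cells)
    also have "\<dots> = (\<Sum>p\<in>V. emeasure M ((case p of (is, a) \<Rightarrow> cell is a) \<inter> C))"
      using C fin disj by (intro sum_emeasure[symmetric]) auto
    finally show ?thesis by (simp add: case_prod_unfold)
  qed
  have uniform_E: "emeasure M (E \<inter> \<alpha> -` B) = emeasure uniform01 B * emeasure M E" if B: "B \<in> sets borel" for B
  proof -
    have "cell is a \<inter> \<alpha> -` B \<in> sets M" if "(is, a) \<in> V" for "is" a
    proof -
      have "cell is a \<inter> \<alpha> -` B = cell is a \<inter> (\<alpha> -` B \<inter> space M)" by (auto simp: cell_def)
      then show ?thesis using cell_sets[OF that] measurable_sets[OF borel_measurable_\<alpha> B] by simp
    qed
    then have "emeasure M (E \<inter> \<alpha> -` B) = (\<Sum>(is, a)\<in>V. emeasure M (cell is a \<inter> \<alpha> -` B))" by (rule E_sum)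
    also have "\<dots> = (\<Sum>(is, a)\<in>V. emeasure uniform01 B * emeasure M (cell is a))"
      using cell_eq B by (intro sum.cong) auto
    also have "\<dots> = emeasure uniform01 B * (\<Sum>(is, a)\<in>V. emeasure M (cell is a))"
      by (simp add: sum_distrib_left case_prod_unfold)
    also have "(\<Sum>(is, a)\<in>V. emeasure M (cell is a)) = emeasure M E"
      using E_sum[of UNIV] cell_sets by simp
    finally show ?thesis .
  qed
  have E_pos: "emeasure M E \<noteq> 0" "emeasure M E \<noteq> \<infinity>"
    using positive by (auto simp: emeasure_eq_measure)
  have "distr (uniform_measure M E) lborel \<alpha> = density lborel (indicator {0<..<1})"
  proof (rule measure_eqI)
    fix B assume "B \<in> sets (distr (uniform_measure M E) lborel \<alpha>)"
    then have B: "B \<in> sets borel" by simp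
    have "emeasure (distr (uniform_measure M E) lborel \<alpha>) B
        = emeasure (uniform_measure M E) (\<alpha> -` B \<inter> space M)"
      using B by (subst emeasure_distr) auto
    also have "\<dots> = emeasure M (E \<inter> \<alpha> -` B) / emeasure M E"
    proof -
      have "E \<inter> (\<alpha> -` B \<inter> space M) = E \<inter> \<alpha> -` B" by (auto simp: E_def)
      then show ?thesis
        using E_sets measurable_sets[OF borel_measurable_\<alpha> B] by simp
    qed
    also have "\<dots> = emeasure uniform01 B"
      using E_pos by (simp add: uniform_E[OF B] ennreal_mult_divide_eq)
    finally show "emeasure (distr (uniform_measure M E) lborel \<alpha>) B
        = emeasure (density lborel (indicator {0<..<1})) B"
      by (simp add: ennreal_indicator)
  qed simp
  then show ?thesis
    unfolding distributed_def \<alpha>_def[abs_def, symmetric] by simp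
qed

end
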